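(* Let $r>1$, $0<p\le1$ and let $S\in\mathbb{N}$. There are constants $c_{p,S}>0$ (depending only on $p,S$) and $C_{r,p,S}>0$ (depending only on $r,p,S$), both independent of $n$ and $d$, such that for all $d\in\mathbb{N}$ with $0<S<d$ and all $n\in\mathbb{N}$, $$\mathrm{err}(n,R_d^{r,(p,S)})\le C_{r,p,S}\begin{cases}1,& 1\le n\le 4d,\\[2pt] \left(\dfrac1{\log(n)}\right)^{r(1/p-1)},& 4d\le n\le c_{p,S}\,2^d d^{1/p-1},\\[6pt] 2^{rd}\,n^{-r},& n\ge c_{p,S}\,2^d d^{1/p-1}.\end{cases}$$
   Context: $\|a\|_p=(\sum_{i=1}^d|a_i|^p)^{1/p}$. For $r>0$ let $m$ be the largest integer strictly less than $r$ and $\beta=r-m\in(0,1]$. $B^{\mathrm{Lip}(r)}$ is the set of all $m$ times continuously differentiable $g:[-1,1]\to\mathbb{R}$ with $\max\{\|g\|_\infty,\|g^{(1)}\|_\infty,\dots,\|g^{(m)}\|_\infty,|g^{(m)}|_\beta\}\le 1$, where $|g^{(m)}|_\beta=\sup_{u\ne v\in[-1,1]}\frac{|g^{(m)}(u)-g^{(m)}(v)|}{2\min\{1,|u-v|\}^\beta}$. $R_d^{r,(p,S)}$ is the set of $f:[-1,1]^d\to\mathbb{R}$, $f(x)=g(a^{T}x)$ with $g\in B^{\mathrm{Lip}(r)}$ and $a\in\mathbb{R}^d$ satisfying $\|a\|_p\le 1$ and $\|a\|_1\ge\min\{1,4S^{1-1/p}\}$. For a class $F_d\subset C([-1,1]^d)$,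 a deterministic algorithm using at most $n$ function values is a map $S_n:F_d\to C([-1,1]^d)$ of the form $S_n(f)=\phi(f(x_1),\dots,f(x_n))$ with an arbitrary map $\phi:\mathbb{R}^n\to C([-1,1]^d)$, where $x_1\in[-1,1]^d$ is fixed (independent of $f$) and $x_i=\psi_i(f(x_1),\dots,f(x_{i-1}))$ for $i=2,\dots,n$ with arbitrary maps $\psi_i:\mathbb{R}^{i-1}\to[-1,1]^d$. The $n$th minimal worst-case error is $\mathrm{err}(n,F_d)=\inf_{S_n}\sup_{f\in F_d}\|f-S_n(f)\|_\infty$, the infimum being over all such algorithms. *)

theory Defs
  imports "HOL-Analysis.Analysis"
begin

text \<open>
  Points of \<open>[-1,1]^d\<close> are functions on the index set \<open>{..<d}\<close>, made total by the fixed value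
  \<open>undefined\<close> at the other indices. Since those coordinates are constant on the cube, the
  product topology on \<^typ>\<open>nat \<Rightarrow> real\<close> induces the Euclidean topology on it.
\<close>

definition cube :: "nat \<Rightarrow> (nat \<Rightarrow> real) set" where
  "cube d = {..<d} \<rightarrow>\<^sub>E {-1..1}"

definition p_norm :: "nat \<Rightarrow> real \<Rightarrow> (nat \<Rightarrow> real) \<Rightarrow> real" where
  "p_norm d p a = (\<Sum>i<d. \<bar>a i\<bar> powr p) powr (1 / p)"

definition sup_norm :: "'a set \<Rightarrow> ('a \<Rightarrow> real) \<Rightarrow> ennreal" where
  "sup_norm A f = (SUP x\<in>A. ennreal \<bar>f x\<bar>)"

definition holder_seminorm :: "real \<Rightarrow> (real \<Rightarrow> real) \<Rightarrow> ennreal" where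
  "holder_seminorm \<beta> h =
     (SUP (u, v) \<in> {(u, v). u \<in> {-1..1} \<and> v \<in> {-1..1} \<and> u \<noteq> v}.
        ennreal (\<bar>h u - h v\<bar> / (2 * min 1 \<bar>u - v\<bar> powr \<beta>)))"

text \<open>
  \<open>D k\<close> is the \<open>k\<close>-th derivative of \<open>g\<close> on \<open>[-1,1]\<close>, one-sided at the end points; its values
  on \<open>[-1,1]\<close> are uniquely determined by \<open>g\<close> for \<open>k \<le> m\<close>.
\<close>

definition has_derivs_upto :: "nat \<Rightarrow> (real \<Rightarrow> real) \<Rightarrow> (nat \<Rightarrow> real \<Rightarrow> real) \<Rightarrow> bool" where
  "has_derivs_upto m g D \<longleftrightarrow>
     (\<forall>x\<in>{-1..1}. D 0 x = g x) \<and>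
     (\<forall>k<m. \<forall>x\<in>{-1..1}. (D k has_real_derivative D (Suc k) x) (at x within {-1..1})) \<and>
     continuous_on {-1..1} (D m)"

text \<open>For \<open>r > 0\<close>, \<open>\<lceil>r\<rceil> - 1\<close> is the largest integer strictly less than \<open>r\<close>, also when \<open>r\<close> is an integer.\<close>

definition smooth_order :: "real \<Rightarrow> nat" where
  "smooth_order r = nat (\<lceil>r\<rceil> - 1)"

definition lip_ball :: "real \<Rightarrow> (real \<Rightarrow> real) set" where
  "lip_ball r = {g. \<exists>D. has_derivs_upto (smooth_order r) g D \<and>
     (\<forall>k\<le>smooth_order r. sup_norm {-1..1} (D k) \<le> 1) \<and>
     holder_seminorm (r - real (smooth_order r)) (D (smooth_order r)) \<le> 1}"

definition ridge_class :: "nat \<Rightarrow> real \<Rightarrow> real \<Rightarrow> nat \<Rightarrow> ((nat \<Rightarrow> real) \<Rightarrow> real) set" where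
  "ridge_class d r p S =
     {(\<lambda>x\<in>cube d. g (\<Sum>i<d. a i * x i)) | g a.
        g \<in> lip_ball r \<and> p_norm d p a \<le> 1 \<and>
        p_norm d 1 a \<ge> min 1 (4 * real S powr (1 - 1 / p))}"

text \<open>
  \<open>observations \<psi> f n\<close> lists the first \<open>n\<close> sampled values of \<open>f\<close>; the sampling point with
  (zero-based) index \<open>k\<close> is \<open>\<psi> k\<close> applied to the \<open>k\<close> values seen so far. In particular the first
  point \<open>\<psi> 0 []\<close> does not depend on \<open>f\<close>.
\<close>

primrec observations ::
    "(nat \<Rightarrow> real list \<Rightarrow> 'a) \<Rightarrow> ('a \<Rightarrow> real) \<Rightarrow> nat \<Rightarrow> real list" where
  "observations \<psi> f 0 = []"
| "observations \<psi> f (Suc n) = observations \<psi> f n @ [f (\<psi> n (observations \<psi> f n))]"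

definition algorithms ::
    "nat \<Rightarrow> nat \<Rightarrow> (((nat \<Rightarrow> real) \<Rightarrow> real) \<Rightarrow> ((nat \<Rightarrow> real) \<Rightarrow> real)) set" where
  "algorithms d n =
     {(\<lambda>f. \<phi> (observations \<psi> f n)) | \<phi> \<psi>.
        (\<forall>k<n. \<forall>ys. length ys = k \<longrightarrow> \<psi> k ys \<in> cube d) \<and>
        (\<forall>ys. length ys = n \<longrightarrow> continuous_on (cube d) (\<phi> ys))}"

definition err :: "nat \<Rightarrow> nat \<Rightarrow> ((nat \<Rightarrow> real) \<Rightarrow> real) set \<Rightarrow> ennreal" where
  "err d n F = (INF A\<in>algorithms d n. SUP f\<in>F. sup_norm (cube d) (\<lambda>x. f x - A f x))"

end

theory Submission
  imports Defs "HOL-Real_Asymp.Real_Asymp"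
begin

text \<open>
  Write \<open>f(x) = g(a\<cdot>x)\<close>. The idea is that the direction \<open>a\<close> need not be known before \<open>g\<close> is
  explored, and that once \<open>f\<close> is seen to vary, the direction comes at the price of
  little more than \<open>d\<close> further values.

  \<^item> Exploration. Let \<open>V\<close> be a set of sign vectors such that every admissible \<open>a\<close> has some
    \<open>v \<in> V\<close> with \<open>a\<cdot>v \<ge> \<parallel>a\<parallel>\<^sub>1 - 2/N\<close>. The values of \<open>f\<close> at the points \<open>(j/N) v\<close>, \<open>|j| \<le> N\<close>, contain
    those of \<open>g\<close> on a grid of mesh at most \<open>1/N\<close> that covers the range \<open>[-\<parallel>a\<parallel>\<^sub>1, \<parallel>a\<parallel>\<^sub>1]\<close> of
    \<open>a\<cdot>x\<close> up to a distance \<open>2/N\<close> at both ends. Which \<open>v\<close> does this is unknown.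
  \<^item> If all these values are within \<open>N\<^sup>-\<^sup>r\<close> of \<open>f(0)\<close>, then \<open>g\<close> is constant up to \<open>O(N\<^sup>-\<^sup>r)\<close> on
    the whole range, including the uncovered ends, because a function of smoothness \<open>r\<close> that is
    small on a grid is small near it (\<open>small_on_grid\<close>). This is where \<open>\<parallel>a\<parallel>\<^sub>1 \<ge> \<kappa> > 0\<close> enters: the
    grid must not be much finer than the gap over which \<open>g\<close> is extrapolated.
  \<^item> Otherwise bisection finds, after \<open>O(N)\<close> more values, a point \<open>x\<^sub>0\<close> at which \<open>\<gamma> = g'(a\<cdot>x\<^sub>0)\<close> has
    modulus at least \<open>N\<^sup>-\<^sup>r/2\<close> (\<open>bisect_deriv_ge\<close>). Difference quotients at \<open>x\<^sub>0\<close> with an extremely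
    small step give \<open>b \<approx> \<gamma> a\<close> to any prescribed accuracy (\<open>slope_error\<close>; here \<open>r > 1\<close> is used),
    hence the direction of \<open>a\<close> up to sign. Sampling along the sign vector \<open>\<sigma>\<close> of \<open>b\<close> then determines
    the profile \<open>t \<mapsto> g(t (a\<cdot>\<sigma>))\<close> up to \<open>O(N\<^sup>-\<^sup>r)\<close>, and \<open>f(x)\<close> is its value at
    \<open>t = b\<cdot>x / \<parallel>b\<parallel>\<^sub>1\<close> up to a negligible error (\<open>direction_error\<close>).

  No reconstruction is ever written down. The algorithm returns some member of the class that is
  consistent with the data, and its error is bounded by the distance of two members with equal data
  (\<open>err_le_radius\<close>). Altogether \<open>|V| (2N+1) + O(N) + d\<close> values suffice for the error \<open>O(N\<^sup>-\<^sup>r)\<close>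
  (\<open>err_le_power\<close>), and the two nontrivial regimes differ only in the choice of \<open>V\<close>.

  With all \<open>2\<^sup>d\<close> sign vectors one may take \<open>N\<close> of order \<open>n 2\<^sup>-\<^sup>d\<close>; this gives \<open>2\<^sup>r\<^sup>d n\<^sup>-\<^sup>r\<close>
  (\<open>err_le_power_rate\<close>). For small \<open>n\<close>, all but the \<open>k\<close> largest entries of \<open>a\<close> have \<open>l\<^sub>1\<close>-norm at most
  \<open>k\<^sup>1\<^sup>-\<^sup>1\<^sup>/\<^sup>p\<close>, so it is enough that \<open>V\<close> realises every sign pattern on every \<open>k\<close>-element set of
  coordinates. A greedy choice produces such a \<open>V\<close> with about \<open>2\<^sup>k k log d\<close> elements
  (\<open>universal_sign_vectors\<close>), which is much less than \<open>n \<ge> 4d\<close> when \<open>k\<close> is about \<open>(log n)/2\<close>. Then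
  \<open>N\<close> is of order \<open>k\<^sup>1\<^sup>/\<^sup>p\<^sup>-\<^sup>1\<close>, which gives the logarithmic rate (\<open>err_le_log_power\<close>).

  The first of these two bounds holds for all \<open>n \<ge> 1\<close> and the second one for all \<open>n \<ge> 4d\<close>, so it does
  not matter where they are glued together; the choice here is \<open>c = 1\<close>.
\<close>

section \<open>Adaptive information\<close>

text \<open>
  \<open>J\<close> is a function of the \<open>n\<close> values seen by one adaptive sampling rule. Treating information of
  arbitrary type as a value makes algorithms composable: the next stage may depend on \<open>J f\<close>.
\<close>

definition learnable :: "nat \<Rightarrow> nat \<Rightarrow> (((nat \<Rightarrow> real) \<Rightarrow> real) \<Rightarrow> 'b) \<Rightarrow> bool" where
  "learnable d n J \<longleftrightarrow>
     (\<exists>\<psi> dec. (\<forall>k ys. \<psi> k ys \<in> cube d) \<and> (\<forall>f. J f = dec (observations \<psi> f n)))"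

lemma length_observations [simp]: "length (observations \<psi> f n) = n"
  by (induction n) auto

text \<open>
  Running \<open>\<psi>\<^sub>1\<close> and then \<open>\<psi>\<^sub>2\<close>, where \<open>\<psi>\<^sub>2\<close> itself may be chosen in view of the values
  \<open>observations \<psi>\<^sub>1 f n\<close>; hence the second premise speaks of that list only.
\<close>

lemma observations_append:
  assumes "\<And>k ys. k < n \<Longrightarrow> \<psi> k ys = \<psi>\<^sub>1 k ys"
    and "\<And>k ys zs. length ys = n \<Longrightarrow> ys = observations \<psi>\<^sub>1 f n \<Longrightarrow> \<psi> (n + k) (ys @ zs) = \<psi>\<^sub>2 k zs"
  shows "observations \<psi> f (n + i) = observations \<psi>\<^sub>1 f n @ observations \<psi>\<^sub>2 f i"
proof -
  have "observations \<psi> f k = observations \<psi>\<^sub>1 f k" if "k \<le> n" for k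
    using that by (induction k) (auto simp: assms(1))
  then show ?thesis
    by (induction i) (auto simp: assms(2))
qed

lemma restrict_mem_cube:
  assumes "\<And>i. i < d \<Longrightarrow> \<bar>x i\<bar> \<le> 1"
  shows "restrict x {..<d} \<in> cube d"
proof -
  have "x i \<in> {-1..1}" if "i < d" for i
    using assms[OF that] by (simp add: abs_le_iff)
  then show ?thesis
    unfolding cube_def by (intro restrict_PiE_iff[THEN iffD2]) auto
qed

lemma cube_abs_le:
  assumes "x \<in> cube d" "i < d"
  shows "\<bar>x i\<bar> \<le> 1"
proof -
  have "x i \<in> {-1..1}"
    using assms unfolding cube_def by (auto dest!: PiE_mem)
  then show ?thesis by auto
qed

lemma learnable_const: "learnable d n (\<lambda>_. c)"
  unfolding learnable_def
  by (intro exI[of _ "\<lambda>_ _. restrict (\<lambda>_. 0) {..<d}"] exI[of _ "\<lambda>_. c"])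
     (auto intro!: restrict_mem_cube)

lemma learnable_query: "x \<in> cube d \<Longrightarrow> learnable d 1 (\<lambda>f. f x)"
  unfolding learnable_def
  by (intro exI[of _ "\<lambda>_ _. x"] exI[of _ hd]) auto

lemma learnable_map: "learnable d n J \<Longrightarrow> learnable d n (\<lambda>f. h (J f))"
  unfolding learnable_def
proof (elim exE conjE)
  fix \<psi> dec
  assume "\<forall>k ys. \<psi> k ys \<in> cube d" "\<forall>f. J f = dec (observations \<psi> f n)"
  then show "\<exists>\<psi> dec. (\<forall>k ys. \<psi> k ys \<in> cube d) \<and> (\<forall>f. h (J f) = dec (observations \<psi> f n))"
    by (intro exI[of _ \<psi>] exI[of _ "\<lambda>ys. h (dec ys)"]) simp
qed

text \<open>
  Sequential composition: the first stage is decoded from the first \<open>n\<close> values, and this selects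
  the sampling rule of the second stage.
\<close>

lemma learnable_bind:
  assumes "learnable d n J" and "\<And>j. learnable d n' (K j)"
  shows "learnable d (n + n') (\<lambda>f. (J f, K (J f) f))"
proof -
  obtain \<psi> dec where 1: "\<And>k ys. \<psi> k ys \<in> cube d" "\<And>f. J f = dec (observations \<psi> f n)"
    using assms(1) unfolding learnable_def by blast
  define P where "P j \<omega> \<longleftrightarrow> (\<forall>k ys. fst \<omega> k ys \<in> cube d) \<and>
      (\<forall>f. K j f = snd \<omega> (observations (fst \<omega>) f n'))" for j \<omega>
  have "\<forall>j. \<exists>\<omega>. P j \<omega>"
    using assms(2) unfolding learnable_def P_def split_paired_Ex fst_conv snd_conv by blast
  from choice[OF this] obtain \<omega> where \<omega>: "\<forall>j. P j (\<omega> j)" ..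
  define \<psi>' dec' where "\<psi>' j = fst (\<omega> j)" and "dec' j = snd (\<omega> j)" for j
  have 2: "\<And>j k ys. \<psi>' j k ys \<in> cube d" "\<And>j f. K j f = dec' j (observations (\<psi>' j) f n')"
    using \<omega> unfolding P_def \<psi>'_def dec'_def by blast+
  define \<gamma> where "\<gamma> k ys = (if k < n then \<psi> k ys else \<psi>' (dec (take n ys)) (k - n) (drop n ys))"
    for k ys
  have "observations \<gamma> f (n + n') = observations \<psi> f n @ observations (\<psi>' (J f)) f n'" for f
    by (rule observations_append) (auto simp: \<gamma>_def 1)
  then show ?thesis
    unfolding learnable_def
    by (intro exI[of _ \<gamma>]
          exI[of _ "\<lambda>ys. (dec (take n ys), dec' (dec (take n ys)) (drop n ys))"])
       (auto simp: \<gamma>_def 1 2)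
qed

lemma learnable_mono:
  assumes "learnable d n J" "n \<le> n'"
  shows "learnable d n' J"
  using learnable_map[OF learnable_bind[OF assms(1) learnable_const[of d "n' - n" "()"]], of fst]
    assms(2) by simp

lemma restrict_insert_upd: "restrict f (insert x W) = (restrict f W)(x := f x)"
  by (auto simp: restrict_def)

lemma learnable_restrict:
  assumes "finite W" "W \<subseteq> cube d"
  shows "learnable d (card W) (\<lambda>f. restrict f W)"
  using assms
proof (induction W rule: finite_induct)
  case empty
  have "(\<lambda>f. restrict f {}) = (\<lambda>_. \<lambda>_. undefined)" by (auto simp: restrict_def)
  then show ?case
    using learnable_const[of d 0] by simp
next
  case (insert x W)
  have "learnable d (card W + 1) (\<lambda>f. (restrict f W, f x))"
    using insert by (intro learnable_bind learnable_query) auto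
  from learnable_map[OF this, of "\<lambda>jy. (fst jy)(x := snd jy)"]
  have "learnable d (card W + 1) (\<lambda>f. (restrict f W)(x := f x))"
    unfolding fst_conv snd_conv .
  then show ?case
    unfolding restrict_insert_upd card_insert_disjoint[OF insert.hyps] Suc_eq_plus1 .
qed

text \<open>
  The output is any member of \<open>F\<close> consistent with the data. It need not depend on the data in a
  computable or continuous way, so the radius of information bounds the error, and continuity of the
  output is inherited from \<open>F\<close>.
\<close>

lemma err_le_radius:
  assumes J: "learnable d n J"
    and cont: "\<And>f. f \<in> F \<Longrightarrow> continuous_on (cube d) f"
    and radius: "\<And>f f' x. f \<in> F \<Longrightarrow> f' \<in> F \<Longrightarrow> J f = J f' \<Longrightarrow> x \<in> cube d \<Longrightarrow> \<bar>f x - f' x\<bar> \<le> E"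
  shows "err d n F \<le> ennreal E"
proof -
  obtain \<psi> dec where \<psi>: "\<And>k ys. \<psi> k ys \<in> cube d" "\<And>f. J f = dec (observations \<psi> f n)"
    using J unfolding learnable_def by blast
  define \<phi> where "\<phi> ys = (if \<exists>f\<in>F. J f = dec ys then SOME f. f \<in> F \<and> J f = dec ys else (\<lambda>_. 0))"
    for ys
  have \<phi>: "\<phi> ys \<in> F \<and> J (\<phi> ys) = dec ys" if "\<exists>f\<in>F. J f = dec ys" for ys
    using someI_ex[of "\<lambda>f. f \<in> F \<and> J f = dec ys"] that by (auto simp: \<phi>_def)
  have "continuous_on (cube d) (\<phi> ys)" for ys
    by (cases "\<exists>f\<in>F. J f = dec ys") (use \<phi> cont in auto, simp add: \<phi>_def)
  then have "(\<lambda>f. \<phi> (observations \<psi> f n)) \<in> algorithms d n"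
    using \<psi>(1) unfolding algorithms_def by blast
  then have "err d n F \<le> (SUP f\<in>F. sup_norm (cube d) (\<lambda>x. f x - \<phi> (observations \<psi> f n) x))"
    unfolding err_def by (rule INF_lower2) simp
  also have "\<dots> \<le> ennreal E"
    unfolding sup_norm_def
  proof (intro SUP_least ennreal_leI)
    fix f x assume "f \<in> F" "x \<in> cube d"
    have "\<phi> (observations \<psi> f n) \<in> F \<and> J (\<phi> (observations \<psi> f n)) = J f"
      using \<phi>[of "observations \<psi> f n"] \<psi>(2)[of f] \<open>f \<in> F\<close> by auto
    then show "\<bar>f x - \<phi> (observations \<psi> f n) x\<bar> \<le> E"
      by (intro radius[OF \<open>f \<in> F\<close> _ _ \<open>x \<in> cube d\<close>]) auto
  qed
  finally show ?thesis .
qed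

section \<open>Smooth functions that are small on a grid\<close>

text \<open>
  The mean value theorem without an order between the two points, for derivatives that are one-sided
  at the ends of the interval.
\<close>

lemma mvt_within:
  fixes F F' :: "real \<Rightarrow> real"
  assumes "\<And>z. z \<in> {u..w} \<Longrightarrow> (F has_real_derivative F' z) (at z within {u..w})"
    and "x \<in> {u..w}" "y \<in> {u..w}"
  obtains \<xi> where "\<xi> \<in> {min x y..max x y}" "F y - F x = F' \<xi> * (y - x)"
proof -
  have *: "\<exists>\<xi>\<in>{a..b}. F b - F a = F' \<xi> * (b - a)" if "a < b" "a \<in> {u..w}" "b \<in> {u..w}" for a b
  proof -
    have "(F has_derivative ((*) (F' z))) (at z within {a..b})" if "z \<in> {a..b}" for z
      using has_field_derivative_imp_has_derivative[OF DERIV_subset[OF assms(1)[of z], of "{a..b}"]]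
        that \<open>a \<in> _\<close> \<open>b \<in> _\<close> by auto
    from mvt_simple[OF \<open>a < b\<close> this] show ?thesis
      by fastforce
  qed
  consider "x < y" | "x = y" | "y < x" by linarith
  then show ?thesis
  proof cases
    case 1
    then show ?thesis using *[of x y] assms that by auto
  next
    case 2
    then show ?thesis using that[of x] by auto
  next
    case 3
    then obtain \<xi> where "\<xi> \<in> {y..x}" "F x - F y = F' \<xi> * (x - y)"
      using *[of y x] assms by auto
    then show ?thesis using 3 that[of \<xi>] by (auto simp: algebra_simps)
  qed
qed

text \<open>
  Induction on the smoothness. Between the two points of each pair \<open>s (2 i), s (2 i + 1)\<close> the mean
  value theorem yields a point where the derivative is at most \<open>2 \<delta> / h\<close>, so \<open>D 1\<close> satisfies the
  hypotheses with half as many points; integrating its bound over the block costs a factor \<open>L h\<close>.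
  This replaces polynomial interpolation, and since \<open>x\<close> may lie outside the convex hull of the
  points it covers extrapolation too.
\<close>

lemma small_on_block:
  fixes D :: "nat \<Rightarrow> real \<Rightarrow> real" and s :: "nat \<Rightarrow> real"
  assumes "0 < h" "0 \<le> L" "w - u \<le> L * h"
    and "\<And>k x. k < m \<Longrightarrow> x \<in> {u..w} \<Longrightarrow> (D k has_real_derivative D (Suc k) x) (at x within {u..w})"
    and "\<And>i. i < 2 ^ m \<Longrightarrow> s i \<in> {u..w}"
    and "\<And>i. Suc i < 2 ^ m \<Longrightarrow> s i + h \<le> s (Suc i)"
    and "\<And>i. i < 2 ^ m \<Longrightarrow> \<bar>D 0 (s i)\<bar> \<le> \<delta>"
    and "\<And>x y. x \<in> {u..w} \<Longrightarrow> y \<in> {u..w} \<Longrightarrow> \<bar>D m x - D m y\<bar> \<le> M"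
    and "x \<in> {u..w}"
  shows "\<bar>D 0 x\<bar> \<le> (1 + 2 * L) ^ m * (\<delta> + h ^ m * M)"
  using assms(4-)
proof (induction m arbitrary: D s \<delta> x)
  case 0
  then show ?case
    using 0(2)[of 0] 0(4)[of 0] 0(5)[of x "s 0"] 0(6) by fastforce
next
  case (Suc m)
  have \<delta>: "0 \<le> \<delta>" using Suc.prems(4)[of 0] by simp
  have M: "0 \<le> M" using Suc.prems(5)[OF Suc.prems(6) Suc.prems(6)] by simp
  let ?K = "(1 + 2 * L) ^ m"
  have K: "1 \<le> ?K" using assms(2) by simp
  have deriv0: "(D 0 has_real_derivative D 1 z) (at z within {u..w})" if "z \<in> {u..w}" for z
    using Suc.prems(1)[of 0 z] that by simp
  \<comment> \<open>Pairing the points \<open>s (2 i)\<close>, \<open>s (2 i + 1)\<close> keeps the new points separated by \<open>h\<close>.\<close>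
  have "\<exists>\<xi>. \<xi> \<in> {s (2 * i)..s (2 * i + 1)} \<and> \<bar>D 1 \<xi>\<bar> \<le> 2 * \<delta> / h" if "i < 2 ^ m" for i
  proof -
    have i: "Suc (2 * i) < 2 ^ Suc m" using that by simp
    have sep: "s (2 * i) + h \<le> s (Suc (2 * i))" using Suc.prems(3)[OF i] .
    obtain \<xi> where \<xi>: "\<xi> \<in> {min (s (2 * i)) (s (2 * i + 1))..max (s (2 * i)) (s (2 * i + 1))}"
      "D 0 (s (2 * i + 1)) - D 0 (s (2 * i)) = D 1 \<xi> * (s (2 * i + 1) - s (2 * i))"
      using mvt_within[of u w "D 0" "D 1" "s (2 * i)" "s (2 * i + 1)"] deriv0
        Suc.prems(2)[of "2 * i"] Suc.prems(2)[of "2 * i + 1"] i by auto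
    have "\<bar>D 1 \<xi>\<bar> * h \<le> \<bar>D 1 \<xi>\<bar> * (s (2 * i + 1) - s (2 * i))"
      using sep by (intro mult_left_mono) auto
    also have "\<dots> = \<bar>D 0 (s (2 * i + 1)) - D 0 (s (2 * i))\<bar>"
      using \<xi>(2) sep assms(1) by (simp add: abs_mult)
    also have "\<dots> \<le> 2 * \<delta>"
      using Suc.prems(4)[of "2 * i"] Suc.prems(4)[of "2 * i + 1"] i by linarith
    finally show ?thesis
      using \<xi>(1) sep assms(1) by (intro exI[of _ \<xi>]) (auto simp: field_simps)
  qed
  then obtain \<xi> where \<xi>: "\<And>i. i < 2 ^ m \<Longrightarrow> \<xi> i \<in> {s (2 * i)..s (2 * i + 1)}"
      "\<And>i. i < 2 ^ m \<Longrightarrow> \<bar>D 1 (\<xi> i)\<bar> \<le> 2 * \<delta> / h"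
    by metis
  have \<xi>_sep: "\<xi> i + h \<le> \<xi> (Suc i)" if "Suc i < 2 ^ m" for i
    using \<xi>(1)[of i] \<xi>(1)[of "Suc i"] Suc.prems(3)[of "2 * i + 1"] that by auto
  have \<xi>_mem: "\<xi> i \<in> {u..w}" if "i < 2 ^ m" for i
    using \<xi>(1)[of i] Suc.prems(2)[of "2 * i"] Suc.prems(2)[of "2 * i + 1"] that by auto
  have D1: "\<bar>D 1 z\<bar> \<le> ?K * (2 * \<delta> / h + h ^ m * M)" if "z \<in> {u..w}" for z
    using Suc.IH[of "\<lambda>k. D (Suc k)" \<xi> "2 * \<delta> / h" z] Suc.prems(1,5) \<xi>(2) \<xi>_sep \<xi>_mem that
    by auto
  obtain \<zeta> where \<zeta>: "\<zeta> \<in> {min (s 0) x..max (s 0) x}" "D 0 x - D 0 (s 0) = D 1 \<zeta> * (x - s 0)"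
    using mvt_within[of u w "D 0" "D 1" "s 0" x] deriv0 Suc.prems(2)[of 0] Suc.prems(6) by auto
  have "\<zeta> \<in> {u..w}"
    using \<zeta>(1) Suc.prems(2)[of 0] Suc.prems(6) by auto
  then have "\<bar>D 1 \<zeta>\<bar> * \<bar>x - s 0\<bar> \<le> (?K * (2 * \<delta> / h + h ^ m * M)) * (L * h)"
    using D1 Suc.prems(2)[of 0] Suc.prems(6) assms(1-3) K \<delta> M
    by (intro mult_mono) auto
  also have "\<dots> = ?K * L * (2 * \<delta> + h ^ Suc m * M)"
    using assms(1) by (simp add: field_simps)
  finally have "\<bar>D 0 x\<bar> \<le> \<delta> + ?K * L * (2 * \<delta> + h ^ Suc m * M)"
    using \<zeta>(2) Suc.prems(4)[of 0] by (simp add: abs_mult[symmetric])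
  also have "\<dots> \<le> ?K * \<delta> + ?K * (h ^ Suc m * M) + ?K * L * (2 * \<delta> + 2 * (h ^ Suc m * M))"
  proof -
    have hM: "0 \<le> h ^ Suc m * M"
      using M assms(1) by (intro mult_nonneg_nonneg) auto
    have "\<delta> \<le> ?K * \<delta>" "0 \<le> ?K * (h ^ Suc m * M)"
      using mult_right_mono[OF K \<delta>] mult_nonneg_nonneg[OF _ hM, of ?K] K by auto
    moreover have "?K * L * (2 * \<delta> + h ^ Suc m * M) \<le> ?K * L * (2 * \<delta> + 2 * (h ^ Suc m * M))"
      using K assms(2) hM by (intro mult_left_mono add_mono mult_nonneg_nonneg) linarith+
    ultimately show ?thesis by linarith
  qed
  also have "\<dots> = (1 + 2 * L) ^ Suc m * (\<delta> + h ^ Suc m * M)"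
    by (simp add: algebra_simps)
  finally show ?case .
qed

text \<open>
  The equidistant points of \<open>[-1,1]\<close> with mesh \<open>1/N\<close>, for indices \<open>0, \<dots>, 2 N\<close>.
\<close>

definition node :: "nat \<Rightarrow> nat \<Rightarrow> real" where
  "node N i = real i / real N - 1"

lemma node_mem: "i \<le> 2 * N \<Longrightarrow> \<bar>node N i\<bar> \<le> 1"
  by (cases "N = 0") (auto simp: node_def abs_le_iff field_simps)

text \<open>
  Any \<open>x\<close> within \<open>2/N\<close> of \<open>[-c,c]\<close> lies in an interval of \<open>O(1)\<close> mesh widths that contains \<open>2\<^sup>m\<close>
  consecutive grid points. The lower bound \<open>\<kappa>\<close> on \<open>c\<close> compares the mesh \<open>c/N\<close> with the overhang \<open>2/N\<close>.
\<close>

lemma small_on_grid: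
  fixes D :: "nat \<Rightarrow> real \<Rightarrow> real"
  assumes \<kappa>: "0 < \<kappa>" "\<kappa> \<le> c" "c \<le> 1" and N: "2 ^ m \<le> N" and \<beta>: "0 \<le> \<beta>"
    and deriv: "\<And>k x. k < m \<Longrightarrow> x \<in> {-1..1} \<Longrightarrow>
       (D k has_real_derivative D (Suc k) x) (at x within {-1..1})"
    and holder: "\<And>x y. x \<in> {-1..1} \<Longrightarrow> y \<in> {-1..1} \<Longrightarrow> \<bar>D m x - D m y\<bar> \<le> 4 * \<bar>x - y\<bar> powr \<beta>"
    and grid: "\<And>i. i \<le> 2 * N \<Longrightarrow> \<bar>D 0 (c * node N i)\<bar> \<le> \<delta>"
    and x: "\<bar>x\<bar> \<le> 1" "\<bar>x\<bar> \<le> c + 2 / real N"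
  defines "L \<equiv> 2 ^ m + 2 / \<kappa>"
  shows "\<bar>D 0 x\<bar> \<le> (1 + 2 * L) ^ m * (\<delta> + 4 * L powr \<beta> * real N powr (- (real m + \<beta>)))"
proof -
  define M :: nat where "M = 2 ^ m"
  have M: "1 \<le> M" "M \<le> N" using N by (auto simp: M_def)
  then have N0: "0 < N" by simp
  have c: "0 < c" using \<kappa> by simp
  define h where "h = c / real N"
  have h: "0 < h" using c N0 by (simp add: h_def)
  have hN: "h * real N = c" using N0 by (simp add: h_def)
  define y where "y = x / h + real N"
  have xy: "x = h * (y - real N)" using h by (simp add: y_def)
  have pt: "c * node N i = h * (real i - real N)" for i
    using N0 by (simp add: h_def node_def field_simps)
  have "\<bar>x / h\<bar> \<le> real N + 2 / c"
  proof -
    have "\<bar>x\<bar> \<le> h * (real N + 2 / c)"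
      using x(2) hN c by (simp add: distrib_left h_def)
    then show ?thesis using h by (simp add: divide_le_eq mult.commute)
  qed
  then have y: "- (2 / c) \<le> y" "y \<le> 2 * real N + 2 / c"
    unfolding y_def by (simp_all only: abs_le_iff) linarith+
  have L: "real M + 2 / c \<le> L" "0 < L"
    using \<kappa> c by (auto simp: L_def M_def intro!: divide_left_mono add_pos_pos)
  \<comment> \<open>\<open>y\<close> is the position of \<open>x\<close> in grid units; the block starts at the grid point to its left,
     moved into the grid where \<open>x\<close> is close to an end or beyond it.\<close>
  define j where "j = min (2 * N - M) (nat \<lfloor>y\<rfloor>)"
  have jM: "j + M \<le> 2 * N" using M by (simp add: j_def)
  have len: "max y (real (j + M)) - min y (real j) \<le> real M + 2 / c"
  proof -
    have c2: "0 < 2 / c" using c by simp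
    consider "y < real j" | "real j \<le> y" "y \<le> real (j + M)" | "real (j + M) < y" by linarith
    then show ?thesis
    proof cases
      case 1
      have "real j \<le> real (nat \<lfloor>y\<rfloor>)" by (simp add: j_def)
      with 1 have "\<lfloor>y\<rfloor> < 0" by linarith
      then have "j = 0" by (simp add: j_def)
      with 1 y show ?thesis by (simp add: max_def min_def)
    next
      case 2
      then show ?thesis using c2 by simp
    next
      case 3
      have "j = 2 * N - M"
      proof (rule ccontr)
        assume "j \<noteq> 2 * N - M"
        then have "j = nat \<lfloor>y\<rfloor>" by (auto simp: j_def min_def split: if_splits)
        then have "y < real j + 1" by linarith
        with 3 M show False by simp
      qed
      then have "real j = 2 * real N - real M" using M by simp
      with 3 y c2 show ?thesis by (simp add: max_def min_def)
    qed
  qed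
  define u w where "u = h * (min y (real j) - real N)" and "w = h * (max y (real (j + M)) - real N)"
  have uw: "w - u \<le> L * h"
  proof -
    have "w - u = (max y (real (j + M)) - min y (real j)) * h"
      by (simp add: u_def w_def algebra_simps)
    also have "\<dots> \<le> L * h" using len L h by (intro mult_right_mono) auto
    finally show ?thesis .
  qed
  have mem: "h * (z - real N) \<in> {u..w}" if "min y (real j) \<le> z" "z \<le> max y (real (j + M))" for z
    using that h by (auto simp: u_def w_def)
  have in1: "\<bar>h * (real i - real N)\<bar> \<le> 1" if "i \<le> 2 * N" for i
  proof -
    have "\<bar>c\<bar> * \<bar>node N i\<bar> \<le> 1 * 1" using node_mem[OF that] \<kappa> by (intro mult_mono) auto
    then show ?thesis by (simp add: pt[symmetric] abs_mult)
  qed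
  have sub: "{u..w} \<subseteq> {-1..1}"
  proof -
    have "-1 \<le> u"
      using in1[of j] jM x(1) xy by (auto simp: u_def min_def abs_le_iff)
    moreover have "w \<le> 1"
      using in1[of "j + M"] jM x(1) xy by (auto simp: w_def max_def abs_le_iff)
    ultimately show ?thesis by auto
  qed
  have *: "\<bar>D 0 x\<bar> \<le> (1 + 2 * L) ^ m * (\<delta> + h ^ m * (4 * (L * h) powr \<beta>))"
  proof (rule small_on_block[where D = D and x = x and u = u and w = w and s = "\<lambda>i. h * (real (j + i) - real N)"])
    show "(D k has_real_derivative D (Suc k) z) (at z within {u..w})" if "k < m" "z \<in> {u..w}" for k z
      using deriv[of k z] that sub by (blast intro: DERIV_subset)
    show "\<bar>D m z - D m z'\<bar> \<le> 4 * (L * h) powr \<beta>" if "z \<in> {u..w}" "z' \<in> {u..w}" for z z'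
    proof -
      have "\<bar>D m z - D m z'\<bar> \<le> 4 * \<bar>z - z'\<bar> powr \<beta>"
        using holder that sub by blast
      also have "\<dots> \<le> 4 * (L * h) powr \<beta>"
        using that uw \<beta> by (intro mult_left_mono powr_mono2) auto
      finally show ?thesis .
    qed
    show "h * (real (j + i) - real N) + h \<le> h * (real (j + Suc i) - real N)" for i
      by (simp add: algebra_simps)
    show "h * (real (j + i) - real N) \<in> {u..w}" if "i < 2 ^ m" for i
    proof (rule mem)
      have "i \<le> M" using that by (simp add: M_def)
      then show "real (j + i) \<le> max y (real (j + M))" by (simp add: le_max_iff_disj)
    qed (simp add: min_le_iff_disj)
    show "\<bar>D 0 (h * (real (j + i) - real N))\<bar> \<le> \<delta>" if "i < 2 ^ m" for i
      using grid[of "j + i"] jM that by (simp add: pt M_def)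
    show "x \<in> {u..w}"
      unfolding xy by (rule mem) auto
  qed (use h L uw in auto)
  have "h ^ m * (4 * (L * h) powr \<beta>) = 4 * L powr \<beta> * h powr (real m + \<beta>)"
    using h L by (simp add: powr_mult powr_add powr_realpow)
  also have "\<dots> \<le> 4 * L powr \<beta> * real N powr (- (real m + \<beta>))"
  proof (rule mult_left_mono)
    have "h powr (real m + \<beta>) \<le> (1 / real N) powr (real m + \<beta>)"
      using h \<kappa> \<beta> by (intro powr_mono2) (auto simp: h_def divide_right_mono)
    also have "\<dots> = real N powr (- (real m + \<beta>))"
      by (subst powr_minus_divide, subst powr_divide) auto
    finally show "h powr (real m + \<beta>) \<le> real N powr (- (real m + \<beta>))" .
  qed simp
  finally have "h ^ m * (4 * (L * h) powr \<beta>) \<le> 4 * L powr \<beta> * real N powr (- (real m + \<beta>))" .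
  then have "(1 + 2 * L) ^ m * (\<delta> + h ^ m * (4 * (L * h) powr \<beta>))
      \<le> (1 + 2 * L) ^ m * (\<delta> + 4 * L powr \<beta> * real N powr (- (real m + \<beta>)))"
    using L by (intro mult_left_mono add_left_mono zero_le_power) auto
  with * show ?thesis by (rule order_trans)
qed

section \<open>Ridge functions\<close>

definition dot :: "nat \<Rightarrow> (nat \<Rightarrow> real) \<Rightarrow> (nat \<Rightarrow> real) \<Rightarrow> real" where
  "dot d a x = (\<Sum>i<d. a i * x i)"

definition l1 :: "nat \<Rightarrow> (nat \<Rightarrow> real) \<Rightarrow> real" where
  "l1 d a = (\<Sum>i<d. \<bar>a i\<bar>)"

text \<open>
  Membership in the Lipschitz ball in terms of the derivatives \<open>D\<close> and real inequalities. The
  truncation of the distance at \<open>1\<close> in the seminorm is dropped, which only weakens the condition.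
\<close>

definition smooth_profile :: "real \<Rightarrow> (nat \<Rightarrow> real \<Rightarrow> real) \<Rightarrow> bool" where
  "smooth_profile r D \<longleftrightarrow>
     (\<forall>k<smooth_order r. \<forall>x\<in>{-1..1}. (D k has_real_derivative D (Suc k) x) (at x within {-1..1})) \<and>
     (\<forall>k\<le>smooth_order r. \<forall>x\<in>{-1..1}. \<bar>D k x\<bar> \<le> 1) \<and>
     (\<forall>x\<in>{-1..1}. \<forall>y\<in>{-1..1}. \<bar>D (smooth_order r) x - D (smooth_order r) y\<bar>
        \<le> 2 * \<bar>x - y\<bar> powr (r - real (smooth_order r)))"

lemma smooth_order_bounds:
  assumes "r > 1"
  shows "1 \<le> smooth_order r" "0 < r - real (smooth_order r)" "r - real (smooth_order r) \<le> 1"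
  using assms unfolding smooth_order_def by linarith+

lemma dot_le_l1: "(\<And>i. i < d \<Longrightarrow> \<bar>x i\<bar> \<le> 1) \<Longrightarrow> \<bar>dot d a x\<bar> \<le> l1 d a"
  unfolding dot_def l1_def
  by (intro order_trans[OF sum_abs] sum_mono) (auto simp: abs_mult mult_left_le)

lemma p_norm_1: "p_norm d 1 a = l1 d a"
  by (simp add: p_norm_def l1_def sum_nonneg)

lemma p_norm_le_1_iff:
  assumes "0 < p"
  shows "p_norm d p a \<le> 1 \<longleftrightarrow> (\<Sum>i<d. \<bar>a i\<bar> powr p) \<le> 1"
proof -
  have "(\<Sum>i<d. \<bar>a i\<bar> powr p) powr (1 / p) \<le> 1 \<longleftrightarrow> (\<Sum>i<d. \<bar>a i\<bar> powr p) \<le> 1" (is "?s powr _ \<le> 1 \<longleftrightarrow> _")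
  proof
    have s: "0 \<le> ?s" by (simp add: sum_nonneg)
    show "?s \<le> 1" if "?s powr (1 / p) \<le> 1"
    proof (rule ccontr)
      assume "\<not> ?s \<le> 1"
      then have "1 < ?s powr (1 / p)" using assms by (intro gr_one_powr) auto
      with that show False by simp
    qed
    show "?s powr (1 / p) \<le> 1" if "?s \<le> 1"
      using powr_mono2[of "1 / p" ?s 1] that s assms by simp
  qed
  then show ?thesis by (simp add: p_norm_def)
qed

text \<open>
  The entries have modulus at most \<open>1\<close>, where \<open>t \<le> t\<^sup>p\<close>.
\<close>

lemma l1_le_1:
  assumes "0 < p" "p \<le> 1" "p_norm d p a \<le> 1"
  shows "l1 d a \<le> 1"
proof -
  have s: "(\<Sum>i<d. \<bar>a i\<bar> powr p) \<le> 1"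
    using assms p_norm_le_1_iff by blast
  have "\<bar>a i\<bar> \<le> \<bar>a i\<bar> powr p" if "i < d" for i
  proof -
    have "\<bar>a i\<bar> powr p \<le> 1"
      using member_le_sum[of i "{..<d}" "\<lambda>i. \<bar>a i\<bar> powr p"] that s by simp
    then have "\<bar>a i\<bar> \<le> 1"
      using gr_one_powr[of "\<bar>a i\<bar>" p] assms(1) by linarith
    then show ?thesis
      using powr_mono'[of p 1 "\<bar>a i\<bar>"] assms by simp
  qed
  then have "l1 d a \<le> (\<Sum>i<d. \<bar>a i\<bar> powr p)"
    unfolding l1_def by (intro sum_mono) auto
  with s show ?thesis by simp
qed

lemma sup_norm_le_1D: "sup_norm A f \<le> 1 \<Longrightarrow> x \<in> A \<Longrightarrow> \<bar>f x\<bar> \<le> 1"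
  unfolding sup_norm_def SUP_le_iff by auto

lemma lip_ballE:
  assumes "g \<in> lip_ball r" "r > 1"
  obtains D where "smooth_profile r D" "\<And>x. x \<in> {-1..1} \<Longrightarrow> D 0 x = g x"
proof -
  define \<beta> where "\<beta> = r - real (smooth_order r)"
  have \<beta>: "0 < \<beta>" using smooth_order_bounds[OF assms(2)] by (simp add: \<beta>_def)
  obtain D where D: "has_derivs_upto (smooth_order r) g D"
    "\<And>k. k \<le> smooth_order r \<Longrightarrow> sup_norm {-1..1} (D k) \<le> 1"
    "holder_seminorm \<beta> (D (smooth_order r)) \<le> 1"
    using assms(1) unfolding lip_ball_def \<beta>_def by auto
  have "\<bar>D (smooth_order r) x - D (smooth_order r) y\<bar> \<le> 2 * \<bar>x - y\<bar> powr \<beta>"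
    if "x \<in> {-1..1}" "y \<in> {-1..1}" for x y
  proof (cases "x = y")
    case False
    have "ennreal (\<bar>D (smooth_order r) x - D (smooth_order r) y\<bar> / (2 * min 1 \<bar>x - y\<bar> powr \<beta>)) \<le> 1"
      using D(3) that False unfolding holder_seminorm_def SUP_le_iff by fastforce
    then have "\<bar>D (smooth_order r) x - D (smooth_order r) y\<bar> / (2 * min 1 \<bar>x - y\<bar> powr \<beta>) \<le> 1"
      by simp
    moreover have "0 < min 1 \<bar>x - y\<bar> powr \<beta>" using False by simp
    ultimately have "\<bar>D (smooth_order r) x - D (smooth_order r) y\<bar> \<le> 2 * min 1 \<bar>x - y\<bar> powr \<beta>"
      by (simp add: divide_le_eq)
    also have "\<dots> \<le> 2 * \<bar>x - y\<bar> powr \<beta>"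
      using \<beta> by (intro mult_left_mono powr_mono2) auto
    finally show ?thesis .
  qed simp
  moreover have "\<bar>D k x\<bar> \<le> 1" if "k \<le> smooth_order r" "x \<in> {-1..1}" for k x
    using sup_norm_le_1D[OF D(2)[OF that(1)] that(2)] .
  moreover have "\<forall>k<smooth_order r. \<forall>x\<in>{-1..1}.
      (D k has_real_derivative D (Suc k) x) (at x within {-1..1})"
    using D(1) unfolding has_derivs_upto_def by blast
  ultimately have "smooth_profile r D"
    unfolding smooth_profile_def \<beta>_def by auto
  moreover have "D 0 x = g x" if "x \<in> {-1..1}" for x
    using D(1) that unfolding has_derivs_upto_def by blast
  ultimately show ?thesis using that by blast
qed

lemma ridge_classE:
  assumes "f \<in> ridge_class d r p S" "r > 1" "0 < p" "p \<le> 1"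
  obtains a D where "smooth_profile r D" "\<And>x. x \<in> cube d \<Longrightarrow> f x = D 0 (dot d a x)"
    "p_norm d p a \<le> 1" "l1 d a \<le> 1" "min 1 (4 * real S powr (1 - 1 / p)) \<le> l1 d a"
proof -
  obtain g a where f: "f = (\<lambda>x\<in>cube d. g (\<Sum>i<d. a i * x i))" and g: "g \<in> lip_ball r"
    and a: "p_norm d p a \<le> 1" "min 1 (4 * real S powr (1 - 1 / p)) \<le> p_norm d 1 a"
    using assms(1) unfolding ridge_class_def by blast
  obtain D where D: "smooth_profile r D" "\<And>x. x \<in> {-1..1} \<Longrightarrow> D 0 x = g x"
    using lip_ballE[OF g assms(2)] by blast
  have l1: "l1 d a \<le> 1" using l1_le_1 assms a by blast
  have "f x = D 0 (dot d a x)" if "x \<in> cube d" for x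
  proof -
    have "\<bar>dot d a x\<bar> \<le> 1"
      using dot_le_l1[of d x a] cube_abs_le[OF that] l1 by fastforce
    then show ?thesis using that by (simp add: f D(2) dot_def abs_le_iff)
  qed
  then show ?thesis using that[OF D(1)] a l1 by (simp add: p_norm_1)
qed

lemma smooth_profile_deriv_1:
  assumes "smooth_profile r D" "r > 1" "x \<in> {-1..1}"
  shows "(D 0 has_real_derivative D 1 x) (at x within {-1..1})"
  using assms smooth_order_bounds[of r] unfolding smooth_profile_def
  by (metis One_nat_def Suc_le_eq)

lemma smooth_profile_lipschitz:
  assumes "smooth_profile r D" "r > 1" "x \<in> {-1..1}" "y \<in> {-1..1}"
  shows "\<bar>D 0 x - D 0 y\<bar> \<le> \<bar>x - y\<bar>"
proof -
  obtain \<xi> where \<xi>: "\<xi> \<in> {min y x..max y x}" "D 0 x - D 0 y = D 1 \<xi> * (x - y)"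
    using mvt_within[of "-1" 1 "D 0" "D 1" y x] smooth_profile_deriv_1[OF assms(1,2)] assms by blast
  have "\<xi> \<in> {-1..1}"
    using \<xi>(1) assms(3,4) by (auto simp: min_def max_def split: if_splits)
  then have "\<bar>D 1 \<xi>\<bar> \<le> 1"
    using assms(1) smooth_order_bounds[OF assms(2)] unfolding smooth_profile_def by blast
  then have "\<bar>D 1 \<xi>\<bar> * \<bar>x - y\<bar> \<le> 1 * \<bar>x - y\<bar>" by (intro mult_right_mono) auto
  then show ?thesis using \<xi>(2) by (simp add: abs_mult)
qed

text \<open>
  For \<open>r \<le> 2\<close> the first derivative is the one that the seminorm controls; for \<open>r > 2\<close> it is even
  Lipschitz because the second derivative is bounded by \<open>1\<close>.
\<close>

lemma smooth_profile_deriv_holder: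
  assumes D: "smooth_profile r D" and r: "r > 1" and xy: "x \<in> {-1..1}" "y \<in> {-1..1}"
  shows "\<bar>D 1 x - D 1 y\<bar> \<le> 2 * \<bar>x - y\<bar> powr min 1 (r - 1)"
proof (cases "smooth_order r = 1")
  case True
  then have "min 1 (r - 1) = r - real (smooth_order r)"
    using smooth_order_bounds[OF r] by simp
  then show ?thesis
    using D xy True unfolding smooth_profile_def by metis
next
  case False
  then have m: "2 \<le> smooth_order r" using smooth_order_bounds[OF r] by simp
  then have "2 \<le> r" using smooth_order_bounds[OF r] by linarith
  have "(D 1 has_real_derivative D 2 z) (at z within {-1..1})" if "z \<in> {-1..1}" for z
    using D m that unfolding smooth_profile_def by (metis Suc_1 Suc_le_eq)
  then obtain \<xi> where \<xi>: "\<xi> \<in> {min y x..max y x}" "D 1 x - D 1 y = D 2 \<xi> * (x - y)"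
    using mvt_within[of "-1" 1 "D 1" "D 2" y x] xy by blast
  have "\<xi> \<in> {-1..1}"
    using \<xi>(1) xy by (auto simp: min_def max_def split: if_splits)
  then have "\<bar>D 2 \<xi>\<bar> \<le> 1"
    using D m unfolding smooth_profile_def by blast
  then have "\<bar>D 2 \<xi>\<bar> * \<bar>x - y\<bar> \<le> 2 * \<bar>x - y\<bar>" by (intro mult_right_mono) auto
  then show ?thesis using \<xi>(2) \<open>2 \<le> r\<close> by (simp add: abs_mult min_def powr_one')
qed

lemma continuous_on_ridge_class:
  assumes "f \<in> ridge_class d r p S" "r > 1" "0 < p" "p \<le> 1"
  shows "continuous_on (cube d) f"
proof -
  obtain a D where D: "smooth_profile r D" "\<And>x. x \<in> cube d \<Longrightarrow> f x = D 0 (dot d a x)"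
    and l1: "l1 d a \<le> 1"
    using ridge_classE[OF assms] by metis
  have "continuous_on {-1..1} (D 0)"
    using smooth_profile_deriv_1[OF D(1) assms(2)] by (intro DERIV_continuous_on)
  moreover have "continuous_on (cube d) (dot d a)"
    unfolding dot_def
    by (intro continuous_intros continuous_on_subset[OF continuous_on_product_coordinates]) auto
  moreover have "dot d a ` cube d \<subseteq> {-1..1}"
  proof (rule image_subsetI)
    fix x assume "x \<in> cube d"
    then have "\<bar>dot d a x\<bar> \<le> 1" using dot_le_l1[of d x a] cube_abs_le[of x d] l1 by fastforce
    then show "dot d a x \<in> {-1..1}" by (auto simp: abs_le_iff)
  qed
  ultimately have "continuous_on (cube d) (\<lambda>x. D 0 (dot d a x))"
    by (rule continuous_on_compose2)
  then show ?thesis by (rule continuous_on_eq) (simp add: D(2))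
qed

section \<open>Finding a steep point by bisection\<close>

text \<open>
  \<open>bisect F k\<close> is the left end of a dyadic interval of length \<open>2\<^sup>-\<^sup>k\<close> in \<open>[0,1]\<close>. Of the two halves the
  one with the larger increment of \<open>F\<close> is kept, so the modulus of the difference quotient never decreases.
\<close>

primrec bisect :: "(real \<Rightarrow> real) \<Rightarrow> nat \<Rightarrow> real" where
  "bisect F 0 = 0"
| "bisect F (Suc k) =
     (let u = bisect F k; h = (1 / 2) ^ Suc k
      in if \<bar>F (u + 2 * h) - F (u + h)\<bar> \<le> \<bar>F (u + h) - F u\<bar> then u else u + h)"

lemma bisect_bounds: "0 \<le> bisect F k" "bisect F k + (1 / 2) ^ k \<le> 1"
proof (induction k)
  case (Suc k)
  { case 1 show ?case using Suc by (simp add: Let_def) }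
  { case 2
    define e :: real where "e = (1 / 2) ^ k"
    have "(1 / 2) ^ Suc k = e / 2" "0 \<le> e" by (simp_all add: e_def)
    moreover have "bisect F k + e \<le> 1" using Suc by (simp add: e_def)
    ultimately show ?case by (auto simp: Let_def simp del: power_Suc) }
qed simp_all

lemma bisect_steep: "\<bar>F 1 - F 0\<bar> \<le> 2 ^ k * \<bar>F (bisect F k + (1 / 2) ^ k) - F (bisect F k)\<bar>"
proof (induction k)
  case (Suc k)
  define u h where "u = bisect F k" and "h = (1 / 2 :: real) ^ Suc k"
  have h: "(1 / 2) ^ k = 2 * h" by (simp add: h_def)
  have "\<bar>F (u + 2 * h) - F u\<bar> \<le> \<bar>F (u + 2 * h) - F (u + h)\<bar> + \<bar>F (u + h) - F u\<bar>"
    by linarith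
  moreover have "bisect F (Suc k) =
      (if \<bar>F (u + 2 * h) - F (u + h)\<bar> \<le> \<bar>F (u + h) - F u\<bar> then u else u + h)"
    by (simp only: bisect.simps Let_def u_def h_def)
  moreover have "u + h + h = u + 2 * h" by simp
  ultimately have "\<bar>F (u + 2 * h) - F u\<bar> \<le> 2 * \<bar>F (bisect F (Suc k) + h) - F (bisect F (Suc k))\<bar>"
    by (smt (verit))
  then have "2 ^ k * \<bar>F (u + 2 * h) - F u\<bar>
      \<le> 2 ^ k * (2 * \<bar>F (bisect F (Suc k) + h) - F (bisect F (Suc k))\<bar>)"
    by (intro mult_left_mono) auto
  with Suc show ?case
    unfolding h u_def[symmetric] h_def[symmetric] by (simp only: power_Suc2 mult.assoc)
qed simp

definition ray :: "nat \<Rightarrow> real \<Rightarrow> (nat \<Rightarrow> real) \<Rightarrow> nat \<Rightarrow> real" where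
  "ray d t w = (\<lambda>i\<in>{..<d}. t * w i)"

definition origin :: "nat \<Rightarrow> nat \<Rightarrow> real" where
  "origin d = (\<lambda>i\<in>{..<d}. 0)"

lemma ray_mem_cube:
  assumes "\<bar>t\<bar> \<le> 1" "w \<in> cube d"
  shows "ray d t w \<in> cube d"
  unfolding ray_def
proof (rule restrict_mem_cube)
  fix i assume "i < d"
  then have "\<bar>t\<bar> * \<bar>w i\<bar> \<le> 1 * 1"
    using assms cube_abs_le by (intro mult_mono) auto
  then show "\<bar>t * w i\<bar> \<le> 1" by (simp add: abs_mult)
qed

lemma origin_mem_cube: "origin d \<in> cube d"
  unfolding origin_def by (rule restrict_mem_cube) simp

lemma dot_ray: "dot d a (ray d t w) = t * dot d a w"
  by (simp add: dot_def ray_def sum_distrib_left mult.left_commute)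

lemma ray_0: "ray d 0 w = origin d"
  by (simp add: ray_def origin_def)

lemma ray_1: "w \<in> cube d \<Longrightarrow> ray d 1 w = w"
  unfolding ray_def cube_def by (auto simp: PiE_def extensional_def)

lemma abs_dot_le_1:
  assumes "l1 d a \<le> 1" "x \<in> cube d"
  shows "\<bar>dot d a x\<bar> \<le> 1"
  using order_trans[OF dot_le_l1[of d x a] assms(1)] cube_abs_le[OF assms(2)] by blast

text \<open>
  The second stage of a composition is defined for every conceivable outcome of the first one,
  including parameters outside \<open>[0,1]\<close> that never arise; clipping keeps its sampling points in the
  cube.
\<close>

definition clip :: "real \<Rightarrow> real" where
  "clip t = max 0 (min 1 t)"

lemma clip_abs_le: "\<bar>clip t\<bar> \<le> 1"
  by (auto simp: clip_def)

lemma clip_eq: "0 \<le> t \<Longrightarrow> t \<le> 1 \<Longrightarrow> clip t = t"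
  by (simp add: clip_def)

lemma learnable_bisect:
  assumes "w \<in> cube d"
  shows "learnable d (3 * k) (\<lambda>f. bisect (\<lambda>t. f (ray d t w)) k)"
proof (induction k)
  case 0
  show ?case using learnable_const by simp
next
  case (Suc k)
  define h :: real where "h = (1 / 2) ^ Suc k"
  define q where "q t = ray d (clip t) w" for t
  have q: "learnable d 1 (\<lambda>f. f (q t))" for t
    unfolding q_def by (intro learnable_query ray_mem_cube clip_abs_le assms)
  have "learnable d (3 * k + (1 + (1 + 1)))
      (\<lambda>f. (bisect (\<lambda>t. f (ray d t w)) k,
        (f (q (bisect (\<lambda>t. f (ray d t w)) k)), f (q (bisect (\<lambda>t. f (ray d t w)) k + h)),
         f (q (bisect (\<lambda>t. f (ray d t w)) k + 2 * h)))))"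
    by (rule learnable_bind[OF Suc learnable_bind[OF q learnable_bind[OF q q]]])
  from learnable_map[OF this, of "\<lambda>z. if \<bar>snd (snd (snd z)) - fst (snd (snd z))\<bar>
      \<le> \<bar>fst (snd (snd z)) - fst (snd z)\<bar> then fst z else fst z + h"]
  have "learnable d (3 * k + (1 + (1 + 1)))
      (\<lambda>f. let u = bisect (\<lambda>t. f (ray d t w)) k
           in if \<bar>f (q (u + 2 * h)) - f (q (u + h))\<bar> \<le> \<bar>f (q (u + h)) - f (q u)\<bar> then u else u + h)"
    by (simp only: fst_conv snd_conv Let_def)
  moreover have "q u = ray d u w" "q (u + h) = ray d (u + h) w" "q (u + 2 * h) = ray d (u + 2 * h) w"
    if "u = bisect F k" for u F
  proof -
    have h: "0 < h" "(1 / 2) ^ k = 2 * h" by (simp_all add: h_def)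
    then have "0 \<le> u" "u + 2 * h \<le> 1"
      using bisect_bounds[of F k] that by auto
    with h show "q u = ray d u w" "q (u + h) = ray d (u + h) w" "q (u + 2 * h) = ray d (u + 2 * h) w"
      by (simp_all add: q_def clip_eq)
  qed
  ultimately show ?case
    by (simp add: Let_def h_def[symmetric] numeral_3_eq_3 del: power_Suc)
qed

text \<open>
  On the final interval the difference quotient of \<open>t \<mapsto> f(t w)\<close> is at least \<open>\<delta>\<close>, so \<open>|g'| \<ge> \<delta>\<close>
  somewhere within \<open>2\<^sup>-\<^sup>k\<close> of \<open>a\<cdot>x\<^sub>0\<close>; the Hoelder condition on \<open>g'\<close> moves this to \<open>a\<cdot>x\<^sub>0\<close> itself at
  the cost of half of \<open>\<delta>\<close>.
\<close>

lemma bisect_deriv_ge: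
  assumes D: "smooth_profile r D" and r: "r > 1"
    and f: "\<And>x. x \<in> cube d \<Longrightarrow> f x = D 0 (dot d a x)" and a: "l1 d a \<le> 1"
    and w: "w \<in> cube d" and jump: "\<delta> \<le> \<bar>f w - f (origin d)\<bar>"
    and k: "2 * ((1 / 2) ^ k) powr min 1 (r - 1) \<le> \<delta> / 2"
  shows "\<delta> / 2 \<le> \<bar>D 1 (dot d a (ray d (bisect (\<lambda>t. f (ray d t w)) k) w))\<bar>"
proof -
  define F where "F t = f (ray d t w)" for t
  define u e where "u = bisect F k" and "e = (1 / 2 :: real) ^ k"
  define s where "s = dot d a w"
  have s: "\<bar>s\<bar> \<le> 1" unfolding s_def by (rule abs_dot_le_1[OF a w])
  have e: "0 < e" by (simp add: e_def)
  have u: "0 \<le> u" "u + e \<le> 1" using bisect_bounds[of F k] by (simp_all add: u_def e_def)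
  have F: "F t = D 0 (t * s)" if "0 \<le> t" "t \<le> 1" for t
    using f[OF ray_mem_cube[OF _ w]] that by (simp add: F_def dot_ray s_def)
  have "\<delta> \<le> \<bar>F 1 - F 0\<bar>"
    using jump by (simp add: F_def ray_0 ray_1[OF w])
  also have "\<dots> \<le> 2 ^ k * \<bar>F (u + e) - F u\<bar>"
    using bisect_steep[of F k] by (simp add: u_def e_def)
  finally have "\<delta> * e \<le> \<bar>F (u + e) - F u\<bar>"
    by (simp add: e_def power_one_over field_simps)
  also have "F (u + e) - F u = D 0 ((u + e) * s) - D 0 (u * s)"
    using u e by (simp add: F)
  finally have incr: "\<delta> * e \<le> \<bar>D 0 ((u + e) * s) - D 0 (u * s)\<bar>" .
  have in1: "t * s \<in> {-1..1}" if "0 \<le> t" "t \<le> 1" for t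
  proof -
    have "\<bar>t\<bar> * \<bar>s\<bar> \<le> 1 * 1" using s that by (intro mult_mono) auto
    then have "\<bar>t * s\<bar> \<le> 1" by (simp add: abs_mult)
    then show ?thesis by (auto simp: abs_le_iff)
  qed
  obtain \<xi> where \<xi>: "\<xi> \<in> {min (u * s) ((u + e) * s)..max (u * s) ((u + e) * s)}"
    "D 0 ((u + e) * s) - D 0 (u * s) = D 1 \<xi> * ((u + e) * s - u * s)"
    using mvt_within[of "-1" 1 "D 0" "D 1" "u * s" "(u + e) * s"]
      smooth_profile_deriv_1[OF D r] in1[of u] in1[of "u + e"] u e by auto
  have "\<bar>\<xi> - u * s\<bar> \<le> \<bar>(u + e) * s - u * s\<bar>"
    using \<xi>(1) by (auto simp: min_def max_def split: if_splits)
  also have "\<dots> = e * \<bar>s\<bar>" using e by (simp add: algebra_simps abs_mult)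
  also have "\<dots> \<le> e * 1" using e s by (intro mult_left_mono) auto
  finally have \<xi>_near: "\<bar>\<xi> - u * s\<bar> \<le> e" by simp
  have \<xi>_mem: "\<xi> \<in> {-1..1}"
    using \<xi>(1) in1[of u] in1[of "u + e"] u e by (auto simp: min_def max_def split: if_splits)
  have "\<delta> * e \<le> (\<bar>D 1 \<xi>\<bar> * \<bar>s\<bar>) * e"
    using incr e unfolding \<xi>(2) by (simp add: algebra_simps abs_mult)
  then have "\<delta> \<le> \<bar>D 1 \<xi>\<bar> * \<bar>s\<bar>" using e by simp
  also have "\<dots> \<le> \<bar>D 1 \<xi>\<bar> * 1" using s by (intro mult_left_mono) auto
  finally have "\<delta> \<le> \<bar>D 1 \<xi>\<bar>" by simp
  moreover have "\<bar>D 1 \<xi> - D 1 (u * s)\<bar> \<le> \<delta> / 2"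
  proof -
    have "\<bar>D 1 \<xi> - D 1 (u * s)\<bar> \<le> 2 * \<bar>\<xi> - u * s\<bar> powr min 1 (r - 1)"
      using smooth_profile_deriv_holder[OF D r \<xi>_mem] in1[of u] u e by auto
    also have "\<dots> \<le> 2 * e powr min 1 (r - 1)"
      using \<xi>_near r by (intro mult_left_mono powr_mono2) auto
    also have "\<dots> \<le> \<delta> / 2" using k by (simp add: e_def)
    finally show ?thesis .
  qed
  ultimately have "\<delta> / 2 \<le> \<bar>D 1 (u * s)\<bar>" by linarith
  then show ?thesis by (simp add: dot_ray s_def u_def F_def[abs_def])
qed

section \<open>Recovering the direction\<close>

text \<open>
  The step in coordinate \<open>i\<close> is taken away from the nearer face, so that the shifted point stays in
  the cube.
\<close>

definition inward :: "(nat \<Rightarrow> real) \<Rightarrow> nat \<Rightarrow> real" where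
  "inward x i = (if 0 < x i then -1 else 1)"

definition nudge :: "nat \<Rightarrow> (nat \<Rightarrow> real) \<Rightarrow> real \<Rightarrow> nat \<Rightarrow> nat \<Rightarrow> real" where
  "nudge d x \<eta> i = (\<lambda>j\<in>{..<d}. x j + (if j = i then inward x i * \<eta> else 0))"

definition slope :: "nat \<Rightarrow> (nat \<Rightarrow> real) \<Rightarrow> real \<Rightarrow> ((nat \<Rightarrow> real) \<Rightarrow> real) \<Rightarrow> nat \<Rightarrow> real" where
  "slope d x \<eta> f i = (f (nudge d x \<eta> i) - f x) / (inward x i * \<eta>)"

lemma nudge_mem_cube:
  assumes "x \<in> cube d" "0 \<le> \<eta>" "\<eta> \<le> 1"
  shows "nudge d x \<eta> i \<in> cube d"
  unfolding nudge_def
proof (rule restrict_mem_cube)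
  fix j assume "j < d"
  then have "\<bar>x j\<bar> \<le> 1" using assms cube_abs_le by blast
  then show "\<bar>x j + (if j = i then inward x i * \<eta> else 0)\<bar> \<le> 1"
    using assms(2,3) by (auto simp: inward_def abs_le_iff)
qed

lemma dot_nudge: "i < d \<Longrightarrow> dot d a (nudge d x \<eta> i) = dot d a x + a i * (inward x i * \<eta>)"
  by (simp add: dot_def nudge_def distrib_left sum.distrib if_distrib[of "(*) _"] sum.delta cong: if_cong)

text \<open>
  The difference quotient equals \<open>g'(\<xi>) a\<^sub>i\<close> with \<open>\<xi>\<close> within \<open>\<eta> |a\<^sub>i|\<close> of \<open>a\<cdot>x\<close>. The error is thus
  proportional to \<open>|a\<^sub>i|\<close>, and its sum does not grow with \<open>d\<close>.
\<close>

lemma slope_error: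
  assumes D: "smooth_profile r D" and r: "r > 1"
    and f: "\<And>x. x \<in> cube d \<Longrightarrow> f x = D 0 (dot d a x)" and a: "l1 d a \<le> 1"
    and x: "x \<in> cube d" and \<eta>: "0 < \<eta>" "\<eta> \<le> 1"
  shows "(\<Sum>i<d. \<bar>slope d x \<eta> f i - D 1 (dot d a x) * a i\<bar>) \<le> 2 * \<eta> powr min 1 (r - 1)"
proof -
  let ?\<theta> = "min 1 (r - 1)"
  have "\<bar>slope d x \<eta> f i - D 1 (dot d a x) * a i\<bar> \<le> 2 * \<eta> powr ?\<theta> * \<bar>a i\<bar>" if i: "i < d" for i
  proof -
    define s t where "s = dot d a x" and "t = dot d a (nudge d x \<eta> i)"
    have st: "s \<in> {-1..1}" "t \<in> {-1..1}"
      using abs_dot_le_1[OF a x] abs_dot_le_1[OF a nudge_mem_cube[of x d \<eta> i]] x \<eta>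
      by (auto simp: s_def t_def abs_le_iff)
    have ts: "t - s = a i * (inward x i * \<eta>)"
      using dot_nudge[OF i] by (simp add: s_def t_def)
    obtain \<xi> where \<xi>: "\<xi> \<in> {min s t..max s t}" "D 0 t - D 0 s = D 1 \<xi> * (t - s)"
      using mvt_within[of "-1" 1 "D 0" "D 1" s t] smooth_profile_deriv_1[OF D r] st by auto
    have "slope d x \<eta> f i = (D 0 t - D 0 s) / (inward x i * \<eta>)"
      using f[OF x] f[OF nudge_mem_cube[of x d \<eta> i]] x \<eta> by (simp add: slope_def s_def t_def)
    also have "\<dots> = D 1 \<xi> * a i"
      using \<eta> by (simp add: \<xi>(2) ts inward_def)
    finally have "slope d x \<eta> f i - D 1 s * a i = (D 1 \<xi> - D 1 s) * a i"
      by (simp add: algebra_simps)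
    moreover have "\<bar>D 1 \<xi> - D 1 s\<bar> \<le> 2 * \<eta> powr ?\<theta>"
    proof -
      have "\<bar>\<xi> - s\<bar> \<le> \<bar>t - s\<bar>"
        using \<xi>(1) by (auto simp: min_def max_def split: if_splits)
      also have "\<dots> \<le> 1 * \<eta>"
      proof -
        have "\<bar>a i\<bar> \<le> l1 d a"
          unfolding l1_def using i by (intro member_le_sum) auto
        then have "\<bar>a i\<bar> * \<eta> \<le> 1 * \<eta>" using a \<eta> by (intro mult_right_mono) auto
        then show ?thesis using \<eta> by (simp add: ts abs_mult inward_def)
      qed
      finally have *: "\<bar>\<xi> - s\<bar> \<le> \<eta>" by simp
      have "\<xi> \<in> {-1..1}" using \<xi>(1) st by (auto simp: min_def max_def split: if_splits)
      then have "\<bar>D 1 \<xi> - D 1 s\<bar> \<le> 2 * \<bar>\<xi> - s\<bar> powr ?\<theta>"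
        using smooth_profile_deriv_holder[OF D r] st by blast
      also have "\<dots> \<le> 2 * \<eta> powr ?\<theta>"
        using * r by (intro mult_left_mono powr_mono2) auto
      finally show ?thesis .
    qed
    ultimately show ?thesis
      unfolding s_def[symmetric] by (simp only: abs_mult) (intro mult_right_mono, auto)
  qed
  then have "(\<Sum>i<d. \<bar>slope d x \<eta> f i - D 1 (dot d a x) * a i\<bar>) \<le> (\<Sum>i<d. 2 * \<eta> powr ?\<theta> * \<bar>a i\<bar>)"
    by (intro sum_mono) auto
  also have "\<dots> = 2 * \<eta> powr ?\<theta> * l1 d a"
    by (simp add: l1_def sum_distrib_left)
  also have "\<dots> \<le> 2 * \<eta> powr ?\<theta> * 1"
    using a by (intro mult_left_mono) auto
  finally show ?thesis by simp
qed

definition signs :: "nat \<Rightarrow> (nat \<Rightarrow> real) \<Rightarrow> nat \<Rightarrow> real" where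
  "signs d b = (\<lambda>i\<in>{..<d}. sgn (b i))"

lemma signs_mem_cube: "signs d b \<in> cube d"
  unfolding signs_def by (rule restrict_mem_cube) (simp add: abs_sgn_eq)

lemma dot_signs: "dot d b (signs d b) = l1 d b"
  by (simp add: dot_def signs_def l1_def linordered_idom_class.abs_sgn)

text \<open>
  If \<open>b = \<gamma> a\<close> exactly, then \<open>\<gamma> (a\<cdot>\<sigma>) = \<parallel>b\<parallel>\<^sub>1\<close> for the sign vector \<open>\<sigma>\<close> of \<open>b\<close>, and
  \<open>a\<cdot>x = (b\<cdot>x / \<parallel>b\<parallel>\<^sub>1) (a\<cdot>\<sigma>)\<close>. The sign and the size of \<open>\<gamma>\<close> cancel, so neither has to be known. In
  general both identities hold up to \<open>\<tau>\<close> after multiplication by \<open>\<gamma>\<close>. For \<open>b = 0\<close> the quotient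
  is \<open>0\<close> and the estimate remains true.
\<close>

lemma direction_error:
  assumes \<tau>: "(\<Sum>i<d. \<bar>b i - \<gamma> * a i\<bar>) \<le> \<tau>" and \<gamma>: "\<gamma> \<noteq> 0" and x: "x \<in> cube d"
  shows "\<bar>dot d a x - (dot d b x / l1 d b) * dot d a (signs d b)\<bar> \<le> 2 * \<tau> / \<bar>\<gamma>\<bar>"
proof -
  define t where "t = dot d b x / l1 d b"
  have bx: "\<bar>dot d b x\<bar> \<le> l1 d b" using dot_le_l1 cube_abs_le[OF x] by blast
  have l1: "0 \<le> l1 d b" by (simp add: l1_def sum_nonneg)
  have t: "\<bar>t\<bar> \<le> 1" using bx l1 by (auto simp: t_def divide_le_eq)
  have tl: "t * l1 d b = dot d b x" using bx by (auto simp: t_def)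
  have err: "\<bar>\<gamma> * dot d a z - dot d b z\<bar> \<le> \<tau>" if "z \<in> cube d" for z
  proof -
    have "\<gamma> * dot d a z - dot d b z = - dot d (\<lambda>i. b i - \<gamma> * a i) z"
      by (simp add: dot_def sum_distrib_left sum_subtractf algebra_simps)
    then have "\<bar>\<gamma> * dot d a z - dot d b z\<bar> \<le> l1 d (\<lambda>i. b i - \<gamma> * a i)"
      using dot_le_l1[of d z "\<lambda>i. b i - \<gamma> * a i"] cube_abs_le[OF that] by simp
    with \<tau> show ?thesis by (simp add: l1_def)
  qed
  have "\<gamma> * (dot d a x - t * dot d a (signs d b))
      = (\<gamma> * dot d a x - dot d b x) - t * (\<gamma> * dot d a (signs d b) - dot d b (signs d b))"
    by (simp add: dot_signs tl[symmetric] algebra_simps)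
  also have "\<bar>\<dots>\<bar> \<le> \<tau> + 1 * \<tau>"
  proof -
    have "\<bar>t\<bar> * \<bar>\<gamma> * dot d a (signs d b) - dot d b (signs d b)\<bar> \<le> 1 * \<tau>"
      using t err[OF signs_mem_cube] by (intro mult_mono) auto
    then show ?thesis using err[OF x] by (simp add: abs_mult[symmetric])
  qed
  finally have "\<bar>\<gamma>\<bar> * \<bar>dot d a x - t * dot d a (signs d b)\<bar> \<le> 2 * \<tau>"
    by (simp only: abs_mult)
  then show ?thesis
    using \<gamma> by (simp add: t_def[symmetric] pos_le_divide_eq mult.commute)
qed

section \<open>The adaptive algorithm\<close>

text \<open>
  Applied to \<open>g - f(0)\<close> on the grid \<open>(a\<cdot>v) j/N\<close>. Its half-width \<open>a\<cdot>v \<ge> \<kappa> - 2/N\<close> is at least \<open>\<kappa>/2\<close>,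
  as \<open>N \<ge> 4/\<kappa>\<close>.
\<close>

lemma flat_if_flat_on_grid:
  assumes D: "smooth_profile r D" and r: "r > 1"
    and f: "\<And>x. x \<in> cube d \<Longrightarrow> f x = D 0 (dot d a x)" and a: "l1 d a \<le> 1"
    and \<kappa>: "0 < \<kappa>" "\<kappa> \<le> l1 d a" and N: "2 ^ smooth_order r \<le> N" "4 / \<kappa> \<le> real N"
    and v: "v \<in> cube d" "l1 d a \<le> dot d a v + 2 / real N"
    and flat: "\<And>i. i \<le> 2 * N \<Longrightarrow> \<bar>f (ray d (node N i) v) - f (origin d)\<bar> \<le> real N powr (- r)"
    and x: "x \<in> cube d"
  defines "L \<equiv> 2 ^ smooth_order r + 2 / (\<kappa> / 2)"
  shows "\<bar>f x - f (origin d)\<bar>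
    \<le> (1 + 2 * L) ^ smooth_order r * (1 + 4 * L powr (r - real (smooth_order r))) * real N powr (- r)"
proof -
  define m where "m = smooth_order r"
  define \<beta> where "\<beta> = r - real m"
  have m: "1 \<le> m" "0 < \<beta>" "real m + \<beta> = r"
    using smooth_order_bounds[OF r] by (simp_all add: m_def \<beta>_def)
  define c where "c = dot d a v"
  define D' where "D' k = (if k = 0 then (\<lambda>z. D 0 z - f (origin d)) else D k)" for k
  have "2 / real N \<le> \<kappa> / 2"
  proof -
    have "0 < real N" using N(2) \<kappa>(1) by (smt (verit) divide_pos_pos)
    then show ?thesis using N(2) \<kappa>(1) by (simp add: field_simps)
  qed
  then have c: "\<kappa> / 2 \<le> c" "c \<le> 1"
    using v \<kappa> abs_dot_le_1[OF a v(1)] unfolding c_def by linarith+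
  have *: "\<bar>D' 0 (dot d a x)\<bar> \<le> (1 + 2 * (2 ^ m + 2 / (\<kappa> / 2))) ^ m *
      (real N powr (- r) + 4 * (2 ^ m + 2 / (\<kappa> / 2)) powr \<beta> * real N powr (- (real m + \<beta>)))"
  proof (rule small_on_grid[where D = D' and x = "dot d a x" and c = c])
    show "(D' k has_real_derivative D' (Suc k) z) (at z within {-1..1})"
      if "k < m" "z \<in> {-1..1}" for k z
    proof -
      have "(D k has_real_derivative D (Suc k) z) (at z within {-1..1})"
        using D that unfolding smooth_profile_def m_def by blast
      then show ?thesis
        by (auto simp: D'_def intro!: derivative_eq_intros)
    qed
    show "\<bar>D' m z - D' m z'\<bar> \<le> 4 * \<bar>z - z'\<bar> powr \<beta>" if "z \<in> {-1..1}" "z' \<in> {-1..1}" for z z'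
    proof -
      have "\<bar>D m z - D m z'\<bar> \<le> 2 * \<bar>z - z'\<bar> powr \<beta>"
        using D that unfolding smooth_profile_def m_def \<beta>_def by blast
      moreover have "0 \<le> \<bar>z - z'\<bar> powr \<beta>" by simp
      moreover have "D' m = D m" using m by (simp add: D'_def)
      ultimately show ?thesis by simp
    qed
    show "\<bar>D' 0 (c * node N i)\<bar> \<le> real N powr (- r)" if "i \<le> 2 * N" for i
      using flat[OF that] f[OF ray_mem_cube[OF node_mem[OF that] v(1)]]
      by (simp add: D'_def dot_ray c_def mult.commute)
    show "\<bar>dot d a x\<bar> \<le> c + 2 / real N"
      using dot_le_l1[of d x a] cube_abs_le[OF x] v(2) unfolding c_def by force
  qed (use \<kappa> c N m abs_dot_le_1[OF a x] in \<open>auto simp: m_def\<close>)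
  have "\<bar>f x - f (origin d)\<bar> = \<bar>D' 0 (dot d a x)\<bar>"
    using f[OF x] by (simp add: D'_def)
  also have "\<dots> \<le> (1 + 2 * L) ^ m * (real N powr (- r) + 4 * L powr \<beta> * real N powr (- r))"
    using *[unfolded m(3)] unfolding L_def m_def .
  finally show ?thesis by (simp add: m_def \<beta>_def algebra_simps)
qed

lemma smooth_profile_scaled_deriv:
  assumes D: "smooth_profile r D" and A: "\<bar>A\<bar> \<le> 1" and k: "k < smooth_order r" and t: "t \<in> {-1..1}"
  shows "((\<lambda>t. A ^ k * D k (t * A)) has_real_derivative A ^ Suc k * D (Suc k) (t * A))
    (at t within {-1..1})"
proof -
  have sub: "(\<lambda>t. t * A) ` {-1..1} \<subseteq> {-1..1}"
  proof (rule image_subsetI)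
    fix t :: real assume "t \<in> {-1..1}"
    then have "\<bar>t\<bar> * \<bar>A\<bar> \<le> 1 * 1" using A by (intro mult_mono) auto
    then have "\<bar>t * A\<bar> \<le> 1" by (simp add: abs_mult)
    then show "t * A \<in> {-1..1}" by (auto simp: abs_le_iff)
  qed
  have "(D k has_real_derivative D (Suc k) (t * A)) (at (t * A) within (\<lambda>t. t * A) ` {-1..1})"
    using D k t sub unfolding smooth_profile_def by (blast intro: DERIV_subset)
  moreover have "((\<lambda>t. t * A) has_real_derivative A) (at t within {-1..1})"
    by (auto intro!: derivative_eq_intros)
  ultimately have "(D k \<circ> (\<lambda>t. t * A) has_real_derivative D (Suc k) (t * A) * A) (at t within {-1..1})"
    by (rule DERIV_image_chain)
  from DERIV_cmult[OF this, of "A ^ k"] show ?thesis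
    by (simp add: o_def mult_ac)
qed

lemma smooth_profile_scaled_holder:
  assumes D: "smooth_profile r D" and r: "r > 1" and A: "\<bar>A\<bar> \<le> 1" and t: "t \<in> {-1..1}" "t' \<in> {-1..1}"
  defines "m \<equiv> smooth_order r"
  shows "\<bar>A ^ m * D m (t * A) - A ^ m * D m (t' * A)\<bar> \<le> 2 * \<bar>t - t'\<bar> powr (r - real m)"
proof -
  have mem: "s * A \<in> {-1..1}" if "s \<in> {-1..1}" for s
  proof -
    have "\<bar>s\<bar> * \<bar>A\<bar> \<le> 1 * 1" using A that by (intro mult_mono) auto
    then have "\<bar>s * A\<bar> \<le> 1" by (simp add: abs_mult)
    then show "s * A \<in> {-1..1}" by (auto simp: abs_le_iff)
  qed
  have "\<bar>A ^ m\<bar> * \<bar>D m (t * A) - D m (t' * A)\<bar> \<le> 1 * (2 * \<bar>t * A - t' * A\<bar> powr (r - real m))"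
    using D mem[OF t(1)] mem[OF t(2)] A unfolding smooth_profile_def m_def
    by (intro mult_mono) (auto simp: power_abs power_le_one)
  also have "\<bar>t * A - t' * A\<bar> \<le> \<bar>t - t'\<bar>"
    using mult_left_mono[OF A, of "\<bar>t - t'\<bar>"] by (simp add: abs_mult[symmetric] left_diff_distrib)
  then have "1 * (2 * \<bar>t * A - t' * A\<bar> powr (r - real m)) \<le> 2 * \<bar>t - t'\<bar> powr (r - real m)"
    using smooth_order_bounds[OF r] by (simp add: powr_mono2 m_def)
  finally show ?thesis by (simp add: abs_mult[symmetric] right_diff_distrib)
qed

text \<open>
  The difference of the two restricted profiles \<open>t \<mapsto> g(t A)\<close> and \<open>t \<mapsto> h(t A')\<close> vanishes on the
  grid and has smoothness \<open>r\<close>, as contracting the argument does not increase the seminorms. The two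
  factors \<open>A\<close> and \<open>A'\<close> may differ.
\<close>

lemma close_if_agree_on_grid:
  assumes D: "smooth_profile r D" and D': "smooth_profile r D'" and r: "r > 1"
    and A: "\<bar>A\<bar> \<le> 1" "\<bar>A'\<bar> \<le> 1" and N: "2 ^ smooth_order r \<le> N"
    and agree: "\<And>i. i \<le> 2 * N \<Longrightarrow> D 0 (node N i * A) = D' 0 (node N i * A')"
    and t: "\<bar>t\<bar> \<le> 1"
  defines "L \<equiv> 2 ^ smooth_order r + 2"
  shows "\<bar>D 0 (t * A) - D' 0 (t * A')\<bar>
    \<le> (1 + 2 * L) ^ smooth_order r * (4 * L powr (r - real (smooth_order r))) * real N powr (- r)"
proof -
  define m where "m = smooth_order r"
  define \<beta> where "\<beta> = r - real m"
  have m: "0 < \<beta>" "real m + \<beta> = r"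
    using smooth_order_bounds[OF r] by (simp_all add: m_def \<beta>_def)
  define E where "E k t = A ^ k * D k (t * A) - A' ^ k * D' k (t * A')" for k t
  have "\<bar>E 0 t\<bar> \<le> (1 + 2 * (2 ^ m + 2 / 1)) ^ m *
      (0 + 4 * (2 ^ m + 2 / 1) powr \<beta> * real N powr (- (real m + \<beta>)))"
  proof (rule small_on_grid[where D = E and x = t and c = 1])
    show "(E k has_real_derivative E (Suc k) z) (at z within {-1..1})"
      if "k < m" "z \<in> {-1..1}" for k z
      unfolding E_def[abs_def] using that m_def
      by (intro DERIV_diff smooth_profile_scaled_deriv[OF D A(1)]
          smooth_profile_scaled_deriv[OF D' A(2)]) auto
    show "\<bar>E m z - E m z'\<bar> \<le> 4 * \<bar>z - z'\<bar> powr \<beta>" if "z \<in> {-1..1}" "z' \<in> {-1..1}" for z z'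
      using smooth_profile_scaled_holder[OF D r A(1) that]
        smooth_profile_scaled_holder[OF D' r A(2) that]
      unfolding E_def m_def[symmetric] \<beta>_def[symmetric] by linarith
    show "\<bar>E 0 (1 * node N i)\<bar> \<le> 0" if "i \<le> 2 * N" for i
      using agree[OF that] by (simp add: E_def)
    show "\<bar>t\<bar> \<le> 1 + 2 / real N" using t by (simp add: add_increasing2)
  qed (use m t N in \<open>auto simp: m_def\<close>)
  then show ?thesis
    unfolding m(2) by (simp add: E_def L_def m_def \<beta>_def)
qed

lemma restrict_eqD: "restrict f W = restrict f' W \<Longrightarrow> w \<in> W \<Longrightarrow> f w = f' w"
  by (metis restrict_apply')

lemma abs_dot_div_l1_le_1: "x \<in> cube d \<Longrightarrow> \<bar>dot d b x / l1 d b\<bar> \<le> 1"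
  using dot_le_l1[of d x b] cube_abs_le[of x d] by (force simp: divide_le_eq)

lemma close_along_recovered_direction:
  assumes D: "smooth_profile r D" and r: "r > 1"
    and f: "\<And>x. x \<in> cube d \<Longrightarrow> f x = D 0 (dot d a x)" and a: "l1 d a \<le> 1"
    and \<tau>: "(\<Sum>i<d. \<bar>b i - \<gamma> * a i\<bar>) \<le> \<tau>" and \<gamma>: "\<gamma> \<noteq> 0" and x: "x \<in> cube d"
  shows "\<bar>f x - D 0 (dot d b x / l1 d b * dot d a (signs d b))\<bar> \<le> 2 * \<tau> / \<bar>\<gamma>\<bar>"
proof -
  define t where "t = dot d b x / l1 d b"
  have "\<bar>t\<bar> * \<bar>dot d a (signs d b)\<bar> \<le> 1 * 1"
    using abs_dot_div_l1_le_1[OF x] abs_dot_le_1[OF a signs_mem_cube]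
    by (intro mult_mono) (auto simp: t_def)
  then have "\<bar>t * dot d a (signs d b)\<bar> \<le> 1" by (simp add: abs_mult)
  then have "\<bar>D 0 (dot d a x) - D 0 (t * dot d a (signs d b))\<bar> \<le> \<bar>dot d a x - t * dot d a (signs d b)\<bar>"
    using abs_dot_le_1[OF a x] by (intro smooth_profile_lipschitz[OF D r]) (auto simp: abs_le_iff)
  also have "\<dots> \<le> 2 * \<tau> / \<bar>\<gamma>\<bar>"
    unfolding t_def by (rule direction_error[OF \<tau> \<gamma> x])
  finally show ?thesis using f[OF x] by (simp add: t_def)
qed

text \<open>
  The four stages are: exploration on \<open>W\<close>, bisection on the segment from the origin to a point
  \<open>pick\<close> where \<open>f\<close> differs visibly from its value at the origin, difference quotients at the point
  \<open>base\<close> found in this way, and sampling along the signs of the recovered direction \<open>dir\<close>. If no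
  such point exists, the last three stages are run from the origin and ignored.

  The accuracy \<open>\<tau> = N\<^sup>-\<^sup>2\<^sup>r\<close> of the direction is chosen because it is divided by
  \<open>|\<gamma>| \<ge> N\<^sup>-\<^sup>r/2\<close> in \<open>direction_error\<close>; any accuracy costs the same number of values.
\<close>

lemma err_le_adaptive:
  assumes r: "r > 1" and p: "0 < p" "p \<le> 1"
    and \<kappa>: "0 < \<kappa>" "\<kappa> = min 1 (4 * real S powr (1 - 1 / p))"
    and N: "2 ^ smooth_order r \<le> N" "4 / \<kappa> \<le> real N"
    and V: "finite V" "V \<subseteq> cube d"
      "\<And>a. p_norm d p a \<le> 1 \<Longrightarrow> \<exists>v\<in>V. l1 d a \<le> dot d a v + 2 / real N"
    and B: "2 * ((1 / 2) ^ B) powr min 1 (r - 1) \<le> real N powr (- r) / 2"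
    and n: "card V * (2 * N + 1) + 1 + 3 * B + (d + 1) + (2 * N + 1) \<le> n"
  defines "m \<equiv> smooth_order r"
  defines "\<beta> \<equiv> r - real m"
  defines "L \<equiv> 2 ^ m + 2 / (\<kappa> / 2)" and "L' \<equiv> 2 ^ m + 2"
  shows "err d n (ridge_class d r p S) \<le> ennreal
    ((2 * ((1 + 2 * L) ^ m * (1 + 4 * L powr \<beta>)) + (1 + 2 * L') ^ m * (4 * L' powr \<beta>) + 8) * real N powr (- r))"
proof -
  define \<theta> where "\<theta> = min 1 (r - 1)"
  define \<delta> where "\<delta> = real N powr (- r)"
  define \<tau> where "\<tau> = real N powr (- (2 * r))"
  define \<eta> where "\<eta> = (\<tau> / 2) powr (1 / \<theta>)"
  have N0: "1 \<le> N" using N(1) by (rule order_trans[rotated]) simp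
  have \<theta>: "0 < \<theta>" using r by (simp add: \<theta>_def)
  have \<delta>: "0 < \<delta>" and \<tau>: "0 < \<tau>" "\<tau> = \<delta> * \<delta>"
    using N0 by (simp_all add: \<delta>_def \<tau>_def powr_add[symmetric])
  have "\<tau> \<le> 1" using powr_mono[of "- (2 * r)" 0 "real N"] N0 r by (simp add: \<tau>_def)
  then have \<eta>: "0 < \<eta>" "\<eta> \<le> 1"
    using \<tau> \<theta> powr_mono2[of "1 / \<theta>" "\<tau> / 2" 1] by (auto simp: \<eta>_def)
  have \<eta>\<tau>: "2 * \<eta> powr \<theta> = \<tau>"
    using \<tau> \<theta> by (simp add: \<eta>_def powr_powr)
  define W where "W = insert (origin d) ((\<lambda>(i, v). ray d (node N i) v) ` ({..2 * N} \<times> V))"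
  define pick where "pick j = (if \<exists>w\<in>W. \<delta> < \<bar>j w - j (origin d)\<bar>
      then SOME w. w \<in> W \<and> \<delta> < \<bar>j w - j (origin d)\<bar> else origin d)" for j :: "(nat \<Rightarrow> real) \<Rightarrow> real"
  define J1 where "J1 = (\<lambda>f :: (nat \<Rightarrow> real) \<Rightarrow> real. restrict f W)"
  define J2 where "J2 f = (J1 f, bisect (\<lambda>t. f (ray d t (pick (J1 f)))) B)" for f
  define base where "base z = ray d (clip (snd z)) (pick (fst z))" for z :: "((nat \<Rightarrow> real) \<Rightarrow> real) \<times> real"
  define G where "G z = insert (base z) (nudge d (base z) \<eta> ` {..<d})" for z
  define J3 where "J3 f = (J2 f, restrict f (G (J2 f)))" for f
  define dir where "dir y = slope d (base (fst y)) \<eta> (snd y)"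
    for y :: "(((nat \<Rightarrow> real) \<Rightarrow> real) \<times> real) \<times> ((nat \<Rightarrow> real) \<Rightarrow> real)"
  define H where "H y = (\<lambda>i. ray d (node N i) (signs d (dir y))) ` {..2 * N}" for y
  define J where "J f = (J3 f, restrict f (H (J3 f)))" for f
  have W: "finite W" "W \<subseteq> cube d"
    using V by (auto simp: W_def intro!: ray_mem_cube node_mem origin_mem_cube)
  have pick: "pick j \<in> cube d" for j
    using W(2) someI_ex[of "\<lambda>w. w \<in> W \<and> \<delta> < \<bar>j w - j (origin d)\<bar>"]
    by (auto simp: pick_def origin_mem_cube)
  have pick_jump: "\<delta> < \<bar>j (pick j) - j (origin d)\<bar> \<and> pick j \<in> W"
    if "\<exists>w\<in>W. \<delta> < \<bar>j w - j (origin d)\<bar>" for j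
    using that someI_ex[of "\<lambda>w. w \<in> W \<and> \<delta> < \<bar>j w - j (origin d)\<bar>"]
    by (auto simp: pick_def)
  have base: "base z \<in> cube d" for z
    unfolding base_def by (intro ray_mem_cube clip_abs_le pick)
  have G: "finite (G z)" "G z \<subseteq> cube d" for z
    using base[of z] \<eta> by (auto simp: G_def intro!: nudge_mem_cube)
  have H: "finite (H y)" "H y \<subseteq> cube d" for y
    by (auto simp: H_def intro!: ray_mem_cube node_mem signs_mem_cube)
  have "card W \<le> card ((\<lambda>(i, v). ray d (node N i) v) ` ({..2 * N} \<times> V)) + 1"
    unfolding W_def using V(1) by (simp add: card_insert_if)
  also have "\<dots> \<le> card ({..2 * N} \<times> V) + 1"
    using V(1) by (intro add_right_mono card_image_le) auto
  finally have "card W \<le> card V * (2 * N + 1) + 1"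
    by (simp add: card_cartesian_product mult.commute)
  with learnable_restrict[OF W] have 1: "learnable d (card V * (2 * N + 1) + 1) J1"
    unfolding J1_def by (rule learnable_mono)
  have 2: "learnable d (card V * (2 * N + 1) + 1 + 3 * B) J2"
    unfolding J2_def[abs_def] by (rule learnable_bind[OF 1 learnable_bisect[OF pick]])
  have "card (G z) \<le> d + 1" for z
    using card_image_le[of "{..<d}" "nudge d (base z) \<eta>"] by (simp add: G_def card_insert_if)
  then have "learnable d (d + 1) (\<lambda>f. restrict f (G z))" for z
    by (rule learnable_mono[OF learnable_restrict[OF G]])
  from learnable_bind[OF 2 this] have 3: "learnable d (card V * (2 * N + 1) + 1 + 3 * B + (d + 1)) J3"
    unfolding J3_def[abs_def] .
  have "card (H y) \<le> 2 * N + 1" for y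
    using card_image_le[of "{..2 * N}" "\<lambda>i. ray d (node N i) (signs d (dir y))"] by (simp add: H_def)
  then have "learnable d (2 * N + 1) (\<lambda>f. restrict f (H y))" for y
    by (rule learnable_mono[OF learnable_restrict[OF H]])
  from learnable_bind[OF 3 this]
  have "learnable d (card V * (2 * N + 1) + 1 + 3 * B + (d + 1) + (2 * N + 1)) J"
    unfolding J_def[abs_def] .
  then have J: "learnable d n J"
    using n by (rule learnable_mono)
  define CA where "CA = (1 + 2 * L) ^ m * (1 + 4 * L powr \<beta>)"
  define CB where "CB = (1 + 2 * L') ^ m * (4 * L' powr \<beta>)"
  have CA: "0 \<le> CA" using \<kappa> by (simp add: CA_def L_def)
  have CB: "0 \<le> CB" by (simp add: CB_def L'_def)
  have "err d n (ridge_class d r p S) \<le> ennreal ((2 * CA + CB + 8) * \<delta>)"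
  proof (rule err_le_radius[OF J])
    show "continuous_on (cube d) f" if "f \<in> ridge_class d r p S" for f
      using continuous_on_ridge_class[OF that r p] .
    fix f f' x
    assume f: "f \<in> ridge_class d r p S" and f': "f' \<in> ridge_class d r p S" and eq: "J f = J f'"
      and x: "x \<in> cube d"
    obtain a D where D: "smooth_profile r D" "\<And>x. x \<in> cube d \<Longrightarrow> f x = D 0 (dot d a x)"
      "p_norm d p a \<le> 1" "l1 d a \<le> 1" "\<kappa> \<le> l1 d a"
      using ridge_classE[OF f r p] unfolding \<kappa>(2) by metis
    obtain a' D' where D': "smooth_profile r D'" "\<And>x. x \<in> cube d \<Longrightarrow> f' x = D' 0 (dot d a' x)"
      "p_norm d p a' \<le> 1" "l1 d a' \<le> 1" "\<kappa> \<le> l1 d a'"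
      using ridge_classE[OF f' r p] unfolding \<kappa>(2) by metis
    have eq3: "J3 f = J3 f'" and eqH: "restrict f (H (J3 f)) = restrict f' (H (J3 f))"
      using eq by (auto simp: J_def)
    have eq2: "J2 f = J2 f'" and eqG: "restrict f (G (J2 f)) = restrict f' (G (J2 f))"
      using eq3 by (auto simp: J3_def)
    have eq1: "J1 f = J1 f'" and equ: "snd (J2 f) = snd (J2 f')"
      using eq2 by (auto simp: J2_def)
    have oW: "origin d \<in> W" by (simp add: W_def)
    have J1: "J1 g w = g w" if "w \<in> W" for g w using that by (simp add: J1_def)
    show "\<bar>f x - f' x\<bar> \<le> (2 * CA + CB + 8) * \<delta>"
    proof (cases "\<exists>w\<in>W. \<delta> < \<bar>J1 f w - J1 f (origin d)\<bar>")
      case False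
      have flat: "\<bar>g x - g (origin d)\<bar> \<le> CA * \<delta>"
        if g: "J1 g = J1 f" and E: "smooth_profile r E" "\<And>x. x \<in> cube d \<Longrightarrow> g x = E 0 (dot d e x)"
          "p_norm d p e \<le> 1" "l1 d e \<le> 1" "\<kappa> \<le> l1 d e" for g E e
      proof -
        obtain v where v: "v \<in> V" "l1 d e \<le> dot d e v + 2 / real N" using V(3)[OF E(3)] by blast
        have "\<bar>g (ray d (node N i) v) - g (origin d)\<bar> \<le> \<delta>" if "i \<le> 2 * N" for i
        proof -
          have "ray d (node N i) v \<in> W" using v(1) that by (auto simp: W_def)
          then show ?thesis using False oW g J1[of _ g] by fastforce
        qed
        with flat_if_flat_on_grid[OF E(1) r E(2,4) \<kappa>(1) E(5) N _ v(2) _ x] v(1) V(2)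
        show ?thesis by (auto simp: CA_def L_def m_def \<beta>_def \<delta>_def)
      qed
      have "f (origin d) = f' (origin d)" using eq1 J1[OF oW] by metis
      with flat[OF refl D] flat[OF eq1[symmetric] D'] have "\<bar>f x - f' x\<bar> \<le> 2 * CA * \<delta>" by linarith
      also have "\<dots> \<le> (2 * CA + CB + 8) * \<delta>" using CB \<delta> by (intro mult_right_mono) auto
      finally show ?thesis .
    next
      case True
      define w where "w = pick (J1 f)"
      define x0 where "x0 = base (J2 f)"
      define b where "b = dir (J3 f)"
      define t where "t = dot d b x / l1 d b"
      have approx: "\<bar>g x - E 0 (t * dot d e (signs d b))\<bar> \<le> 4 * \<delta>"
        if g: "J3 g = J3 f" and E: "smooth_profile r E" "\<And>x. x \<in> cube d \<Longrightarrow> g x = E 0 (dot d e x)"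
          "l1 d e \<le> 1" for g E e
      proof -
        have g2: "J2 g = J2 f" and gG: "restrict g (G (J2 f)) = restrict f (G (J2 f))"
          using g by (auto simp: J3_def)
        have g1: "J1 g = J1 f" using g2 by (auto simp: J2_def)
        have jump: "\<delta> \<le> \<bar>g w - g (origin d)\<bar>"
          using pick_jump[OF True] J1[of _ g] oW g1 unfolding w_def by fastforce
        define u where "u = bisect (\<lambda>t. g (ray d t w)) B"
        have J2g: "J2 g = (J1 f, u)" by (simp add: J2_def g1 u_def w_def)
        have u: "clip u = u"
          using bisect_bounds[of "\<lambda>t. g (ray d t w)" B] zero_le_power[of "1 / 2 :: real" B]
          unfolding u_def by (intro clip_eq) linarith+
        have x0: "x0 = ray d u w" using J2g unfolding g2 by (simp add: x0_def base_def u w_def)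
        define \<gamma> where "\<gamma> = E 1 (dot d e x0)"
        have \<gamma>: "\<delta> / 2 \<le> \<bar>\<gamma>\<bar>"
          unfolding \<gamma>_def x0 u_def
          using B pick by (intro bisect_deriv_ge[OF E(1) r E(2,3) _ jump]) (auto simp: w_def \<delta>_def)
        have slope: "b i = slope d x0 \<eta> g i" if "i < d" for i
        proof -
          have "nudge d x0 \<eta> i \<in> G (J2 f)" "x0 \<in> G (J2 f)"
            using that by (auto simp: G_def x0_def)
          then show ?thesis
            using restrict_eqD[OF gG]
            by (simp add: b_def dir_def J3_def slope_def x0_def[symmetric])
        qed
        have "(\<Sum>i<d. \<bar>b i - \<gamma> * e i\<bar>) = (\<Sum>i<d. \<bar>slope d x0 \<eta> g i - E 1 (dot d e x0) * e i\<bar>)"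
          by (intro sum.cong) (auto simp: slope \<gamma>_def)
        also have "\<dots> \<le> \<tau>"
          using slope_error[OF E(1) r E(2,3) _ \<eta>, of x0] base by (simp add: x0_def \<eta>\<tau> \<theta>_def[symmetric])
        finally have "\<bar>g x - E 0 (t * dot d e (signs d b))\<bar> \<le> 2 * \<tau> / \<bar>\<gamma>\<bar>"
          unfolding t_def using \<gamma> \<delta> by (intro close_along_recovered_direction[OF E(1) r E(2,3) _ _ x]) auto
        also have "\<dots> \<le> 2 * \<tau> / (\<delta> / 2)"
          using \<gamma> \<delta> \<tau> by (intro divide_left_mono) auto
        also have "\<dots> = 4 * \<delta>" using \<delta> by (simp add: \<tau>(2))
        finally show ?thesis .
      qed
      have agree: "D 0 (node N i * dot d a (signs d b)) = D' 0 (node N i * dot d a' (signs d b))"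
        if "i \<le> 2 * N" for i
      proof -
        have "ray d (node N i) (signs d b) \<in> H (J3 f)" using that by (auto simp: H_def b_def)
        from restrict_eqD[OF eqH this] show ?thesis
          using D(2) D'(2) ray_mem_cube[OF node_mem[OF that] signs_mem_cube, of d b]
          by (simp add: dot_ray)
      qed
      have "\<bar>D 0 (t * dot d a (signs d b)) - D' 0 (t * dot d a' (signs d b))\<bar> \<le> CB * \<delta>"
        unfolding CB_def L'_def m_def \<beta>_def \<delta>_def
      proof (rule close_if_agree_on_grid[OF D(1) D'(1) r abs_dot_le_1[OF D(4) signs_mem_cube]
            abs_dot_le_1[OF D'(4) signs_mem_cube] N(1) agree])
        show "\<bar>t\<bar> \<le> 1" unfolding t_def by (rule abs_dot_div_l1_le_1[OF x])
      qed
      with approx[OF refl D(1,2,4)] approx[OF eq3[symmetric] D'(1,2,4)]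
      have "\<bar>f x - f' x\<bar> \<le> (CB + 8) * \<delta>" by (simp add: distrib_right)
      also have "\<dots> \<le> (2 * CA + CB + 8) * \<delta>" using CA \<delta> by (intro mult_right_mono) auto
      finally show ?thesis .
    qed
  qed
  then show ?thesis unfolding CA_def CB_def \<delta>_def .
qed

lemma err_le_2:
  assumes "r > 1" "0 < p" "p \<le> 1"
  shows "err d n (ridge_class d r p S) \<le> ennreal 2"
proof (rule err_le_radius[OF learnable_const])
  show "continuous_on (cube d) f" if "f \<in> ridge_class d r p S" for f
    using continuous_on_ridge_class[OF that assms] .
  have bound: "\<bar>f x\<bar> \<le> 1" if f: "f \<in> ridge_class d r p S" and x: "x \<in> cube d" for f x
  proof -
    obtain a D where D: "smooth_profile r D" "\<And>x. x \<in> cube d \<Longrightarrow> f x = D 0 (dot d a x)" "l1 d a \<le> 1"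
      using ridge_classE[OF f assms] by metis
    have "dot d a x \<in> {-1..1}" using abs_dot_le_1[OF D(3) x] by (auto simp: abs_le_iff)
    then show ?thesis using D(1) D(2)[OF x] unfolding smooth_profile_def by simp
  qed
  fix f f' x assume "f \<in> ridge_class d r p S" "f' \<in> ridge_class d r p S" "x \<in> cube d"
  then show "\<bar>f x - f' x\<bar> \<le> 2"
    using bound[of f x] bound[of f' x] by simp
qed

text \<open>
  Linearly many bisection steps suffice, as \<open>2\<^sup>-\<^sup>N\<close> beats \<open>N\<^sup>-\<^sup>1\<close>.
\<close>

lemma half_power_budget:
  fixes \<theta> r :: real
  assumes "0 < r" "r + 2 \<le> real b * \<theta>" "1 \<le> N"
  shows "2 * ((1 / 2) ^ (b * N)) powr \<theta> \<le> real N powr (- r) / 2"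
proof -
  have "((1 / 2 :: real) ^ (b * N)) powr \<theta> = 2 powr (- (real b * \<theta> * real N))"
    by (simp add: powr_realpow[symmetric] powr_powr powr_divide powr_minus_divide[symmetric] mult_ac)
  also have "\<dots> \<le> 2 powr (- ((r + 2) * real N))"
    using assms by (intro powr_mono) (auto intro!: mult_right_mono)
  also have "\<dots> = (2 ^ N) powr (- r) * 2 powr (- (2 * real N))"
    by (simp add: powr_realpow[symmetric] powr_powr powr_add[symmetric] algebra_simps)
  also have "\<dots> \<le> real N powr (- r) * 2 powr (- 2)"
  proof (intro mult_mono powr_mono2')
    show "real N \<le> 2 ^ N" using of_nat_less_two_power[of N, where ?'a = real] by simp
  qed (use assms in \<open>auto intro!: powr_mono\<close>)
  also have "(2 :: real) powr (- 2) = 1 / 4" by (simp add: powr_minus_divide)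
  finally show ?thesis by simp
qed

text \<open>
  Small \<open>N\<close>, for which the grid has too few points, are absorbed into the constant.
\<close>

lemma err_le_power:
  fixes r p :: real and S :: nat
  assumes r: "r > 1" and p: "0 < p" "p \<le> 1" and S: "0 < S"
  obtains C :: real and b :: nat where "0 < C"
    "\<And>d N V n. \<lbrakk>1 \<le> N; finite V; V \<subseteq> cube d;
       \<And>a. p_norm d p a \<le> 1 \<Longrightarrow> \<exists>v\<in>V. l1 d a \<le> dot d a v + 2 / real N;
       card V * (2 * N + 1) + b * N + d \<le> n\<rbrakk>
     \<Longrightarrow> err d n (ridge_class d r p S) \<le> ennreal (C * real N powr (- r))"
proof -
  define \<kappa> where "\<kappa> = min 1 (4 * real S powr (1 - 1 / p))"
  have \<kappa>: "0 < \<kappa>" using S by (simp add: \<kappa>_def)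
  define \<theta> where "\<theta> = min 1 (r - 1)"
  have \<theta>: "0 < \<theta>" using r by (simp add: \<theta>_def)
  define b where "b = nat \<lceil>(r + 2) / \<theta>\<rceil>"
  have b: "r + 2 \<le> real b * \<theta>"
  proof -
    have "(r + 2) / \<theta> \<le> real b" unfolding b_def by linarith
    then show ?thesis using \<theta> by (simp add: divide_le_eq)
  qed
  define m where "m = smooth_order r"
  define \<beta> where "\<beta> = r - real m"
  define L where "L = 2 ^ m + 2 / (\<kappa> / 2)"
  define L' :: real where "L' = 2 ^ m + 2"
  define C1 where "C1 = 2 * ((1 + 2 * L) ^ m * (1 + 4 * L powr \<beta>)) + (1 + 2 * L') ^ m * (4 * L' powr \<beta>) + 8"
  define N1 where "N1 = 2 ^ m + 4 / \<kappa>"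
  have C1: "0 \<le> C1" using \<kappa> by (simp add: C1_def L_def L'_def)
  have N1: "0 < N1" using \<kappa> by (simp add: N1_def add_pos_pos)
  define C where "C = C1 + 2 * N1 powr r"
  have C: "0 < C" using C1 N1 by (simp add: C_def add_nonneg_pos)
  show ?thesis
  proof (rule that[OF C])
    fix d N n :: nat and V :: "(nat \<Rightarrow> real) set"
    assume N: "1 \<le> N" and V: "finite V" "V \<subseteq> cube d"
      "\<And>a. p_norm d p a \<le> 1 \<Longrightarrow> \<exists>v\<in>V. l1 d a \<le> dot d a v + 2 / real N"
      and n: "card V * (2 * N + 1) + (3 * b + 5) * N + d \<le> n"
    show "err d n (ridge_class d r p S) \<le> ennreal (C * real N powr (- r))"
    proof (cases "2 ^ m \<le> N \<and> 4 / \<kappa> \<le> real N")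
      case True
      have "card V * (2 * N + 1) + 1 + 3 * (b * N) + (d + 1) + (2 * N + 1) \<le> n"
        using n N by (simp add: algebra_simps)
      then have "err d n (ridge_class d r p S) \<le> ennreal (C1 * real N powr (- r))"
        using True half_power_budget[OF _ b N] r unfolding C1_def L_def L'_def \<beta>_def m_def
        by (intro err_le_adaptive[OF r p \<kappa> \<kappa>_def _ _ V]) (auto simp: \<theta>_def)
      also have "\<dots> \<le> ennreal (C * real N powr (- r))"
        by (intro ennreal_leI mult_right_mono) (auto simp: C_def)
      finally show ?thesis .
    next
      case False
      have "real N \<le> N1"
      proof -
        have "N < 2 ^ m \<or> real N < 4 / \<kappa>"
          using False by (simp add: not_le)
        then have "real N < 2 ^ m \<or> real N < 4 / \<kappa>"
          using of_nat_less_iff[of N "2 ^ m", where ?'a = real] by simp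
        moreover have "0 \<le> 4 / \<kappa>" "0 \<le> (2 :: real) ^ m" using \<kappa> by simp_all
        ultimately show ?thesis unfolding N1_def by linarith
      qed
      then have "real N powr r \<le> N1 powr r" using r by (intro powr_mono2) auto
      then have "2 \<le> 2 * N1 powr r * real N powr (- r)"
        using N by (simp add: powr_minus_divide le_divide_eq)
      also have "\<dots> \<le> C * real N powr (- r)"
        using C1 by (intro mult_right_mono) (auto simp: C_def)
      finally show ?thesis
        using err_le_2[OF r p] by (meson ennreal_leI order_trans)
    qed
  qed
qed

section \<open>Sign vectors\<close>

text \<open>
  By double counting, some element of \<open>X\<close> satisfies at least the fraction \<open>q\<close> of the requirements
  that are still open. Choosing it leaves at most the fraction \<open>1 - q\<close> of them.
\<close>

lemma greedy_cover:
  fixes q :: real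
  assumes X: "finite X" "X \<noteq> {}" and R: "finite R" and q: "0 \<le> q" "q \<le> 1"
    and often: "\<And>\<rho>. \<rho> \<in> R \<Longrightarrow> q * real (card X) \<le> real (card {v \<in> X. P v \<rho>})"
  shows "\<exists>V\<subseteq>X. card V \<le> T \<and> real (card {\<rho> \<in> R. \<forall>v\<in>V. \<not> P v \<rho>}) \<le> (1 - q) ^ T * real (card R)"
proof (induction T)
  case 0
  show ?case by (intro exI[of _ "{}"]) simp
next
  case (Suc T)
  then obtain V where V: "V \<subseteq> X" "card V \<le> T"
    "real (card {\<rho> \<in> R. \<forall>v\<in>V. \<not> P v \<rho>}) \<le> (1 - q) ^ T * real (card R)" by blast
  define U where "U = {\<rho> \<in> R. \<forall>v\<in>V. \<not> P v \<rho>}"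
  have U: "finite U" "U \<subseteq> R" using R by (auto simp: U_def)
  have "\<exists>v\<in>X. q * real (card U) \<le> real (card {\<rho> \<in> U. P v \<rho>})"
  proof (rule ccontr)
    assume "\<not> ?thesis"
    then have "(\<Sum>v\<in>X. real (card {\<rho> \<in> U. P v \<rho>})) < (\<Sum>v\<in>X. q * real (card U))"
      using X by (intro sum_strict_mono) (auto simp: not_le)
    moreover have "(\<Sum>v\<in>X. real (card {\<rho> \<in> U. P v \<rho>})) = (\<Sum>\<rho>\<in>U. real (card {v \<in> X. P v \<rho>}))"
      using sum.swap_restrict[OF X(1) U(1), of "\<lambda>_ _. 1 :: real" P] by simp
    moreover have "(\<Sum>\<rho>\<in>U. q * real (card X)) \<le> (\<Sum>\<rho>\<in>U. real (card {v \<in> X. P v \<rho>}))"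
      using often U by (intro sum_mono) auto
    ultimately show False by (simp add: mult_ac)
  qed
  then obtain v where v: "v \<in> X" "q * real (card U) \<le> real (card {\<rho> \<in> U. P v \<rho>})" by blast
  have "{\<rho> \<in> R. \<forall>w\<in>insert v V. \<not> P w \<rho>} = U - {\<rho> \<in> U. P v \<rho>}"
    by (auto simp: U_def)
  moreover have "real (card (U - {\<rho> \<in> U. P v \<rho>})) = real (card U) - real (card {\<rho> \<in> U. P v \<rho>})"
    using U by (subst card_Diff_subset) (auto intro: of_nat_diff card_mono)
  moreover have "real (card U) - real (card {\<rho> \<in> U. P v \<rho>}) \<le> (1 - q) * real (card U)"
    using v(2) by (simp add: algebra_simps)
  moreover have "(1 - q) * real (card U) \<le> (1 - q) * ((1 - q) ^ T * real (card R))"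
    using V(3) q by (intro mult_left_mono) (auto simp: U_def)
  ultimately have "real (card {\<rho> \<in> R. \<forall>w\<in>insert v V. \<not> P w \<rho>}) \<le> (1 - q) ^ Suc T * real (card R)"
    by (simp add: mult_ac)
  moreover have "card (insert v V) \<le> Suc T"
    using V(2) card_insert_le_m1[of "Suc T" V v] by simp
  ultimately show ?case using V(1) v(1) by (intro exI[of _ "insert v V"]) auto
qed

definition sign_vectors :: "nat \<Rightarrow> (nat \<Rightarrow> real) set" where
  "sign_vectors d = {..<d} \<rightarrow>\<^sub>E {-1, 1}"

lemma finite_sign_vectors: "finite (sign_vectors d)"
  unfolding sign_vectors_def by (intro finite_PiE) auto

lemma card_sign_vectors: "card (sign_vectors d) = 2 ^ d"
  unfolding sign_vectors_def by (simp add: card_PiE numeral_2_eq_2)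

lemma sign_vectors_subset_cube: "sign_vectors d \<subseteq> cube d"
  unfolding sign_vectors_def cube_def by (intro PiE_mono) auto

lemma card_sign_vectors_extending:
  assumes "K \<subseteq> {..<d}" "e \<in> K \<rightarrow>\<^sub>E {-1, 1}"
  shows "card {v \<in> sign_vectors d. \<forall>i\<in>K. v i = e i} = 2 ^ (d - card K)"
proof -
  have "{v \<in> sign_vectors d. \<forall>i\<in>K. v i = e i} = (\<Pi>\<^sub>E i\<in>{..<d}. if i \<in> K then {e i} else {-1, 1})"
    unfolding sign_vectors_def
  proof (intro set_eqI iffI)
    fix v assume v: "v \<in> {v \<in> {..<d} \<rightarrow>\<^sub>E {-1, 1}. \<forall>i\<in>K. v i = e i}"
    then show "v \<in> (\<Pi>\<^sub>E i\<in>{..<d}. if i \<in> K then {e i} else {-1, 1})"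
      by (auto simp: PiE_iff)
  next
    fix v assume v: "v \<in> (\<Pi>\<^sub>E i\<in>{..<d}. if i \<in> K then {e i} else {-1, 1})"
    then have *: "v i \<in> (if i \<in> K then {e i} else {-1, 1})" if "i < d" for i
      using that by (auto simp: PiE_iff)
    have "v i = e i" if "i \<in> K" for i using *[of i] that assms(1) by auto
    moreover have "v i \<in> {-1, 1}" if "i < d" for i
      using *[OF that] PiE_mem[OF assms(2), of i] by (auto split: if_splits)
    ultimately show "v \<in> {v \<in> {..<d} \<rightarrow>\<^sub>E {-1, 1}. \<forall>i\<in>K. v i = e i}"
      using v by (auto simp: PiE_iff)
  qed
  also have "card \<dots> = (\<Prod>i<d. if i \<in> K then 1 else 2)"
    by (subst card_PiE) (auto intro!: prod.cong)
  also have "\<dots> = 2 ^ card ({..<d} - K)"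
    by (simp add: prod.If_cases Diff_eq)
  also have "card ({..<d} - K) = d - card K"
    using assms(1) by (subst card_Diff_subset) (auto intro: finite_subset)
  finally show ?thesis .
qed

text \<open>
  A requirement is a \<open>k\<close>-element set \<open>K\<close> with a sign pattern on it. There are at most \<open>(2 d)\<^sup>k\<close>
  requirements, and each one is met by the fraction \<open>2\<^sup>-\<^sup>k\<close> of all sign vectors. After \<open>T\<close> greedy
  steps fewer than one requirement is open.
\<close>

lemma universal_sign_vectors:
  assumes k: "k \<le> d" and T: "2 ^ k * (real k * ln (2 * real d)) < real T" and d: "1 \<le> d"
  shows "\<exists>V\<subseteq>sign_vectors d. card V \<le> T \<and>
    (\<forall>K\<subseteq>{..<d}. card K = k \<longrightarrow> (\<forall>e\<in>K \<rightarrow>\<^sub>E {-1, 1}. \<exists>v\<in>V. \<forall>i\<in>K. v i = e i))"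
proof -
  define R :: "(nat set \<times> (nat \<Rightarrow> real)) set"
    where "R = (SIGMA K:{K. K \<subseteq> {..<d} \<and> card K = k}. K \<rightarrow>\<^sub>E {-1, 1})"
  define P where "P v \<rho> \<longleftrightarrow> (\<forall>i\<in>fst \<rho>. v i = snd \<rho> i)" for v :: "nat \<Rightarrow> real" and \<rho> :: "nat set \<times> (nat \<Rightarrow> real)"
  define q :: real where "q = (1 / 2) ^ k"
  have fin: "finite (K \<rightarrow>\<^sub>E {-1, 1 :: real})" if "K \<subseteq> {..<d}" for K
    using that by (intro finite_PiE) (auto intro: finite_subset)
  have "card R = (\<Sum>K\<in>{K. K \<subseteq> {..<d} \<and> card K = k}. card (K \<rightarrow>\<^sub>E {-1, 1 :: real}))"
    unfolding R_def by (rule card_SigmaI) (auto intro: fin)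
  also have "\<dots> = (\<Sum>K\<in>{K. K \<subseteq> {..<d} \<and> card K = k}. 2 ^ k)"
  proof (intro sum.cong refl)
    fix K assume K: "K \<in> {K. K \<subseteq> {..<d} \<and> card K = k}"
    then have "finite K" by (auto intro: finite_subset)
    with K show "card (K \<rightarrow>\<^sub>E {-1, 1 :: real}) = 2 ^ k" by (simp add: card_PiE numeral_2_eq_2)
  qed
  also have "\<dots> = (d choose k) * 2 ^ k" by (simp add: n_subsets)
  finally have cardR: "card R = (d choose k) * 2 ^ k" .
  have "finite R" unfolding R_def by (intro finite_SigmaI) (auto intro: fin)
  moreover have "q * real (card (sign_vectors d)) \<le> real (card {v \<in> sign_vectors d. P v \<rho>})" if "\<rho> \<in> R" for \<rho>
  proof -
    have "card {v \<in> sign_vectors d. P v \<rho>} = 2 ^ (d - k)"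
      unfolding P_def using card_sign_vectors_extending[of "fst \<rho>" d "snd \<rho>"] that by (auto simp: R_def)
    moreover have "(2 :: real) ^ (d - k) = 2 ^ d / 2 ^ k" using k by (simp add: power_diff)
    ultimately show ?thesis
      by (simp add: q_def card_sign_vectors power_one_over)
  qed
  moreover have "sign_vectors d \<noteq> {}" using card_sign_vectors[of d] by force
  moreover have "0 \<le> q" "q \<le> 1" by (auto simp: q_def power_le_one)
  ultimately obtain V where V: "V \<subseteq> sign_vectors d" "card V \<le> T"
    "real (card {\<rho> \<in> R. \<forall>v\<in>V. \<not> P v \<rho>}) \<le> (1 - q) ^ T * real (card R)"
    using greedy_cover[OF finite_sign_vectors, of d R q P T] by blast
  have "(1 - q) ^ T * real (card R) < 1"
  proof -
    have "(1 - q) ^ T \<le> exp (- q) ^ T"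
      using exp_ge_add_one_self[of "- q"] \<open>q \<le> 1\<close> by (intro power_mono) auto
    also have "\<dots> = exp (- (q * real T))" by (simp add: exp_of_nat_mult[symmetric] mult.commute)
    also have "\<dots> < exp (- (real k * ln (2 * real d)))"
    proof -
      have "real k * ln (2 * real d) < q * real T"
        using T by (simp add: q_def power_one_over field_simps)
      then show ?thesis by simp
    qed
    also have "\<dots> = 1 / (2 * real d) ^ k"
      using d by (simp add: exp_minus exp_of_nat_mult inverse_eq_divide)
    finally have "(1 - q) ^ T < 1 / (2 * real d) ^ k" .
    moreover have "real (card R) \<le> (2 * real d) ^ k" "0 < real (card R)"
    proof -
      have "(d choose k) * 2 ^ k \<le> d ^ k * 2 ^ k"
        using k by (intro mult_right_mono binomial_le_pow) auto
      then have "real ((d choose k) * 2 ^ k) \<le> real (d ^ k * 2 ^ k)" by (rule of_nat_mono)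
      then show "real (card R) \<le> (2 * real d) ^ k" by (simp add: cardR power_mult_distrib mult.commute)
      show "0 < real (card R)" using k by (simp add: cardR)
    qed
    ultimately have "(1 - q) ^ T * real (card R) < 1 / (2 * real d) ^ k * (2 * real d) ^ k"
      using \<open>q \<le> 1\<close> by (intro mult_less_le_imp_less) auto
    then show ?thesis using d by simp
  qed
  with V(3) have "card {\<rho> \<in> R. \<forall>v\<in>V. \<not> P v \<rho>} = 0" by linarith
  then have "{\<rho> \<in> R. \<forall>v\<in>V. \<not> P v \<rho>} = {}" using \<open>finite R\<close> by simp
  then have "\<exists>v\<in>V. P v (K, e)" if "K \<subseteq> {..<d}" "card K = k" "e \<in> K \<rightarrow>\<^sub>E {-1, 1}" for K e
    using that by (auto simp: R_def)
  then show ?thesis using V(1,2) by (intro exI[of _ V]) (auto simp: P_def)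
qed

text \<open>
  At most \<open>k\<close> entries satisfy \<open>|a\<^sub>i|\<^sup>p > 1/k\<close>. For the others
  \<open>|a\<^sub>i| = |a\<^sub>i|\<^sup>1\<^sup>-\<^sup>p |a\<^sub>i|\<^sup>p \<le> k\<^sup>1\<^sup>-\<^sup>1\<^sup>/\<^sup>p |a\<^sub>i|\<^sup>p\<close>, and the right-hand sides are summable.
\<close>

lemma l1_tail:
  assumes p: "0 < p" "p \<le> 1" and a: "p_norm d p a \<le> 1" and k: "1 \<le> k"
  shows "\<exists>K\<subseteq>{..<d}. card K = min k d \<and> (\<Sum>i\<in>{..<d} - K. \<bar>a i\<bar>) \<le> real k powr (1 - 1 / p)"
proof -
  have s: "(\<Sum>i<d. \<bar>a i\<bar> powr p) \<le> 1" using a p_norm_le_1_iff[OF p(1)] by blast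
  define K0 where "K0 = {i \<in> {..<d}. 1 / real k < \<bar>a i\<bar> powr p}"
  have K0: "K0 \<subseteq> {..<d}" by (auto simp: K0_def)
  have "real (card K0) * (1 / real k) \<le> (\<Sum>i\<in>K0. \<bar>a i\<bar> powr p)"
    by (intro sum_bounded_below) (auto simp: K0_def)
  also have "\<dots> \<le> (\<Sum>i<d. \<bar>a i\<bar> powr p)" using K0 by (intro sum_mono2) auto
  finally have "real (card K0) * (1 / real k) \<le> 1" using s by linarith
  then have "real (card K0) \<le> real k" using k by (simp add: divide_le_eq)
  moreover have "card K0 \<le> d" using card_mono[OF _ K0] by simp
  ultimately obtain K where K: "K0 \<subseteq> K" "K \<subseteq> {..<d}" "card K = min k d"
    using exists_subset_between[of K0 "min k d" "{..<d}"] K0 by auto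
  have "\<bar>a i\<bar> \<le> real k powr (1 - 1 / p) * \<bar>a i\<bar> powr p" if i: "i \<in> {..<d} - K" for i
  proof (cases "a i = 0")
    case False
    have "\<bar>a i\<bar> powr p \<le> 1 / real k" using i K(1) by (force simp: K0_def)
    then have "(\<bar>a i\<bar> powr p) powr (1 / p - 1) \<le> (1 / real k) powr (1 / p - 1)"
      using p by (intro powr_mono2) (auto simp: field_simps)
    moreover have "(\<bar>a i\<bar> powr p) powr (1 / p - 1) = \<bar>a i\<bar> powr (1 - p)"
      using p by (simp add: powr_powr right_diff_distrib)
    moreover have "(1 / real k) powr (1 / p - 1) = real k powr (1 - 1 / p)"
      using powr_minus_divide[of "real k" "1 / p - 1"] by (simp add: powr_divide)
    ultimately have "\<bar>a i\<bar> powr (1 - p) * \<bar>a i\<bar> powr p \<le> real k powr (1 - 1 / p) * \<bar>a i\<bar> powr p"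
      by (intro mult_right_mono) auto
    then show ?thesis using False by (simp add: powr_add[symmetric])
  qed simp
  then have "(\<Sum>i\<in>{..<d} - K. \<bar>a i\<bar>) \<le> (\<Sum>i\<in>{..<d} - K. real k powr (1 - 1 / p) * \<bar>a i\<bar> powr p)"
    by (rule sum_mono)
  also have "\<dots> = real k powr (1 - 1 / p) * (\<Sum>i\<in>{..<d} - K. \<bar>a i\<bar> powr p)"
    by (simp add: sum_distrib_left)
  also have "\<dots> \<le> real k powr (1 - 1 / p) * 1"
  proof (rule mult_left_mono)
    have "(\<Sum>i\<in>{..<d} - K. \<bar>a i\<bar> powr p) \<le> (\<Sum>i<d. \<bar>a i\<bar> powr p)" by (intro sum_mono2) auto
    with s show "(\<Sum>i\<in>{..<d} - K. \<bar>a i\<bar> powr p) \<le> 1" by simp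
  qed simp
  finally show ?thesis using K by auto
qed

lemma dot_ge_if_signs_match:
  assumes v: "v \<in> sign_vectors d" and K: "K \<subseteq> {..<d}"
    and match: "\<And>i. i \<in> K \<Longrightarrow> v i = (if a i < 0 then -1 else 1)"
  shows "l1 d a \<le> dot d a v + 2 * (\<Sum>i\<in>{..<d} - K. \<bar>a i\<bar>)"
proof -
  have "l1 d a - dot d a v = (\<Sum>i<d. \<bar>a i\<bar> - a i * v i)"
    by (simp add: l1_def dot_def sum_subtractf)
  also have "\<dots> \<le> (\<Sum>i<d. if i \<in> K then 0 else 2 * \<bar>a i\<bar>)"
  proof (rule sum_mono)
    fix i assume "i \<in> {..<d}"
    then have "v i \<in> {-1, 1}" using v by (auto simp: sign_vectors_def PiE_iff)
    then show "\<bar>a i\<bar> - a i * v i \<le> (if i \<in> K then 0 else 2 * \<bar>a i\<bar>)"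
      using match[of i] by auto
  qed
  also have "\<dots> = 2 * (\<Sum>i\<in>{..<d} - K. \<bar>a i\<bar>)"
    by (simp add: sum.If_cases Diff_eq sum_distrib_left)
  finally show ?thesis by simp
qed

lemma nearly_norming_sign_vectors:
  assumes p: "0 < p" "p \<le> 1" and k: "1 \<le> k" and d: "1 \<le> d"
  shows "\<exists>V\<subseteq>sign_vectors d. real (card V) \<le> 2 ^ k * (real k * ln (2 * real d)) + 1 \<and>
    (\<forall>a. p_norm d p a \<le> 1 \<longrightarrow> (\<exists>v\<in>V. l1 d a \<le> dot d a v + 2 * real k powr (1 - 1 / p)))"
proof -
  define z where "z = 2 ^ k * (real k * ln (2 * real d))"
  define T where "T = nat (\<lfloor>z\<rfloor> + 1)"
  have ln0: "0 \<le> ln (2 * real d)" using d by simp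
  have z: "0 \<le> z" using ln0 by (simp add: z_def)
  have T: "z < real T" "real T \<le> z + 1" using z unfolding T_def by linarith+
  have "2 ^ min k d * (real (min k d) * ln (2 * real d)) \<le> z"
    unfolding z_def using ln0 by (intro mult_mono power_increasing) auto
  then have "2 ^ min k d * (real (min k d) * ln (2 * real d)) < real T"
    using T(1) by linarith
  from universal_sign_vectors[OF min.cobounded2 this d]
  obtain V where V: "V \<subseteq> sign_vectors d" "card V \<le> T"
    "\<forall>K\<subseteq>{..<d}. card K = min k d \<longrightarrow> (\<forall>e\<in>K \<rightarrow>\<^sub>E {-1, 1}. \<exists>v\<in>V. \<forall>i\<in>K. v i = e i)"
    by blast
  have "\<exists>v\<in>V. l1 d a \<le> dot d a v + 2 * real k powr (1 - 1 / p)" if a: "p_norm d p a \<le> 1" for a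
  proof -
    obtain K where K: "K \<subseteq> {..<d}" "card K = min k d"
      "(\<Sum>i\<in>{..<d} - K. \<bar>a i\<bar>) \<le> real k powr (1 - 1 / p)"
      using l1_tail[OF p a k] by blast
    have "(\<lambda>i\<in>K. if a i < 0 then -1 else 1) \<in> K \<rightarrow>\<^sub>E {-1, 1 :: real}" by auto
    then obtain v where v: "v \<in> V" "\<forall>i\<in>K. v i = (\<lambda>i\<in>K. if a i < 0 then -1 else 1) i"
      using V(3) K(1,2) by blast
    have "l1 d a \<le> dot d a v + 2 * (\<Sum>i\<in>{..<d} - K. \<bar>a i\<bar>)"
      using v V(1) by (intro dot_ge_if_signs_match K(1)) auto
    with K(3) v(1) show ?thesis by (intro bexI[of _ v]) auto
  qed
  then show ?thesis using V(1,2) T(2) by (intro exI[of _ V]) (auto simp: z_def)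
qed

lemma norming_sign_vectors: "\<exists>v\<in>sign_vectors d. l1 d a \<le> dot d a v"
proof -
  define v where "v = (\<lambda>i\<in>{..<d}. if a i < 0 then -1 else 1 :: real)"
  have "v \<in> sign_vectors d" by (auto simp: v_def sign_vectors_def)
  moreover have "l1 d a \<le> dot d a v + 2 * (\<Sum>i\<in>{..<d} - {..<d}. \<bar>a i\<bar>)"
    using \<open>v \<in> sign_vectors d\<close> by (rule dot_ge_if_signs_match) (auto simp: v_def)
  ultimately show ?thesis by auto
qed

section \<open>The error bounds\<close>

text \<open>
  With \<open>k = \<lfloor>(ln n)/2\<rfloor>\<close> one has \<open>2\<^sup>k \<le> \<surd>n\<close>, so the exploration takes \<open>\<surd>n\<close> times a power of
  \<open>ln n\<close> values and fits into the \<open>3n/4\<close> values that remain after the \<open>d \<le> n/4\<close> difference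
  quotients. The finitely many \<open>n\<close> for which this fails are absorbed into the constant.
\<close>

lemma err_le_log_power:
  fixes r p :: real and S :: nat
  assumes r: "r > 1" and p: "0 < p" "p \<le> 1" and S: "0 < S"
  shows "\<exists>C>0. \<forall>d n. 1 \<le> d \<longrightarrow> 4 * d \<le> n \<longrightarrow>
    err d n (ridge_class d r p S) \<le> ennreal (C * (1 / ln (real n)) powr (r * (1 / p - 1)))"
proof -
  define q where "q = 1 / p - 1"
  have q: "0 \<le> q" using p by (simp add: q_def)
  obtain C0 b where C0: "0 < C0" and algo: "\<And>d N V n. \<lbrakk>1 \<le> N; finite V; V \<subseteq> cube d;
       \<And>a. p_norm d p a \<le> 1 \<Longrightarrow> \<exists>v\<in>V. l1 d a \<le> dot d a v + 2 / real N;
       card V * (2 * N + 1) + b * N + d \<le> n\<rbrakk>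
     \<Longrightarrow> err d n (ridge_class d r p S) \<le> ennreal (C0 * real N powr (- r))"
    using err_le_power[OF r p S] by blast
  \<comment> \<open>The exponent \<open>q + 1\<close> instead of \<open>q\<close> is generous, and it is positive also for \<open>p = 1\<close>.\<close>
  have q1: "0 < q + 1" using q by simp
  have "\<forall>\<^sub>F x in at_top. (sqrt x * (ln x * ln x) + 1) * (2 * ln x powr (q + 1) + 1)
      + real b * ln x powr (q + 1) \<le> 3 * x / 4"
    using q1 by real_asymp
  moreover have "\<forall>\<^sub>F x :: real in at_top. 4 \<le> ln x" by real_asymp
  ultimately have "\<forall>\<^sub>F x in at_top. 4 \<le> ln x \<and>
      (sqrt x * (ln x * ln x) + 1) * (2 * ln x powr (q + 1) + 1)
      + real b * ln x powr (q + 1) \<le> 3 * x / 4"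
    by eventually_elim auto
  then obtain x1 where "\<forall>x\<ge>x1. 4 \<le> ln x \<and>
      (sqrt x * (ln x * ln x) + 1) * (2 * ln x powr (q + 1) + 1)
      + real b * ln x powr (q + 1) \<le> 3 * x / 4"
    unfolding eventually_at_top_linorder by blast
  then obtain x0 where x0: "4 \<le> x0" and large: "\<And>x. x0 \<le> x \<Longrightarrow> 4 \<le> ln x"
      "\<And>x. x0 \<le> x \<Longrightarrow> (sqrt x * (ln x * ln x) + 1) * (2 * ln x powr (q + 1) + 1)
      + real b * ln x powr (q + 1) \<le> 3 * x / 4"
    by (intro that[of "max 4 x1"]) auto
  define C where "C = C0 * (2 * 4 powr q) powr r + 2 * ln x0 powr (r * q)"
  have C: "0 < C" using C0 x0 by (simp add: C_def add_pos_nonneg)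
  have "err d n (ridge_class d r p S) \<le> ennreal (C * (1 / ln (real n)) powr (r * q))"
    if d: "1 \<le> d" and n: "4 * d \<le> n" for d n
  proof (cases "x0 \<le> real n")
    case True
    define l where "l = ln (real n)"
    have l: "4 \<le> l" using large(1)[OF True] by (simp add: l_def)
    have n0: "0 < real n" using d n by simp
    define k where "k = nat \<lfloor>l / 2\<rfloor>"
    have k: "1 \<le> k" "real k \<le> l / 2" "l / 4 \<le> real k" using l unfolding k_def by linarith+
    define N where "N = nat \<lfloor>real k powr q\<rfloor>"
    have kq: "1 \<le> real k powr q" using k q by (simp add: ge_one_powr_ge_zero)
    have N: "1 \<le> N" "real N \<le> real k powr q" "real k powr q / 2 \<le> real N"
    proof -
      have "1 \<le> \<lfloor>real k powr q\<rfloor>" using kq by simp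
      then show "1 \<le> N" "real N \<le> real k powr q" "real k powr q / 2 \<le> real N"
        unfolding N_def by linarith+
    qed
    obtain V where V: "V \<subseteq> sign_vectors d" "real (card V) \<le> 2 ^ k * (real k * ln (2 * real d)) + 1"
      "\<And>a. p_norm d p a \<le> 1 \<Longrightarrow> \<exists>v\<in>V. l1 d a \<le> dot d a v + 2 * real k powr (1 - 1 / p)"
      using nearly_norming_sign_vectors[OF p k(1) d] by blast
    have two_k: "(2 :: real) ^ k \<le> sqrt (real n)"
    proof -
      have "(2 :: real) ^ k \<le> exp 1 ^ k"
        using exp_ge_add_one_self[of 1] by (intro power_mono) auto
      also have "\<dots> = exp (real k)" by (simp add: exp_of_nat_mult[symmetric])
      also have "\<dots> \<le> exp (l / 2)" using k by simp
      also have "\<dots> = sqrt (real n)"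
        using n0 by (simp add: l_def powr_half_sqrt[symmetric] powr_def)
      finally show ?thesis .
    qed
    have kl: "real k * ln (2 * real d) \<le> l * l"
      using k l d n unfolding l_def by (intro mult_mono) auto
    have "2 ^ k * (real k * ln (2 * real d)) \<le> sqrt (real n) * (l * l)"
      by (rule mult_mono[OF two_k kl]) (use d in auto)
    with V(2) have cardV: "real (card V) \<le> sqrt (real n) * (l * l) + 1" by linarith
    have Nl: "real N \<le> l powr (q + 1)"
    proof -
      have "real N \<le> l powr q" using N(2) powr_mono2[of q "real k" l] k l q by linarith
      also have "\<dots> \<le> l powr (q + 1)" using l by (intro powr_mono) auto
      finally show ?thesis .
    qed
    have "real (card V * (2 * N + 1) + b * N + d)
        \<le> (sqrt (real n) * (l * l) + 1) * (2 * l powr (q + 1) + 1) + real b * l powr (q + 1) + real n / 4"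
      unfolding of_nat_add of_nat_mult using cardV Nl n
      by (intro add_mono mult_mono) auto
    also have "\<dots> \<le> real n" using large(2)[OF True] unfolding l_def by linarith
    finally have budget: "card V * (2 * N + 1) + b * N + d \<le> n" by (simp only: of_nat_le_iff)
    have "real k powr (1 - 1 / p) \<le> 1 / real N"
    proof -
      have "real k powr (1 - 1 / p) = 1 / real k powr q"
        using powr_minus_divide[of "real k" q] by (simp add: q_def)
      also have "\<dots> \<le> 1 / real N" using N by (intro divide_left_mono) (use k(1) in auto)
      finally show ?thesis .
    qed
    then have "\<exists>v\<in>V. l1 d a \<le> dot d a v + 2 / real N" if "p_norm d p a \<le> 1" for a
      using V(3)[OF that] by force
    then have "err d n (ridge_class d r p S) \<le> ennreal (C0 * real N powr (- r))"
      using V(1) finite_subset[OF V(1) finite_sign_vectors] sign_vectors_subset_cube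
      by (intro algo[OF N(1) _ _ _ budget]) auto
    also have "\<dots> \<le> ennreal (C * (1 / l) powr (r * q))"
    proof (rule ennreal_leI)
      have "l powr q / (2 * 4 powr q) = (l / 4) powr q / 2"
        using l by (simp add: powr_divide)
      also have "\<dots> \<le> real k powr q / 2" using k l q by (intro divide_right_mono powr_mono2) auto
      also note N(3)
      finally have "l powr q / (2 * 4 powr q) \<le> real N" .
      then have "real N powr (- r) \<le> (l powr q / (2 * 4 powr q)) powr (- r)"
        using r l by (intro powr_mono2') auto
      also have "\<dots> = (2 * 4 powr q) powr r * (1 / l) powr (r * q)"
        using l by (simp add: powr_divide powr_powr powr_minus_divide mult.commute)
      finally have "C0 * real N powr (- r) \<le> C0 * ((2 * 4 powr q) powr r * (1 / l) powr (r * q))"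
        using C0 by (intro mult_left_mono) auto
      also have "\<dots> \<le> C * (1 / l) powr (r * q)"
        by (simp add: C_def distrib_right mult.assoc)
      finally show "C0 * real N powr (- r) \<le> C * (1 / l) powr (r * q)" .
    qed
    finally show ?thesis by (simp add: l_def)
  next
    case False
    define l where "l = ln (real n)"
    have l: "0 < l" "l \<le> ln x0" using d n False by (auto simp: l_def)
    have "1 \<le> (ln x0 * (1 / l)) powr (r * q)"
      using l r q by (intro ge_one_powr_ge_zero) auto
    also have "\<dots> = ln x0 powr (r * q) * (1 / l) powr (r * q)"
      using l by (intro powr_mult)
    finally have "2 \<le> 2 * ln x0 powr (r * q) * (1 / l) powr (r * q)" by simp
    also have "\<dots> \<le> C * (1 / l) powr (r * q)"
      using C0 by (intro mult_right_mono) (auto simp: C_def)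
    finally show ?thesis
      using err_le_2[OF r p] unfolding l_def by (meson ennreal_leI order_trans)
  qed
  then show ?thesis using C by (auto simp: q_def)
qed

text \<open>
  The budget suffices for \<open>N = \<lfloor>n / (2\<^sup>d (b + 4))\<rfloor>\<close>. If this is \<open>0\<close>, then \<open>2\<^sup>r\<^sup>d n\<^sup>-\<^sup>r\<close> is bounded below
  and the bound is trivial.
\<close>

lemma err_le_power_rate:
  fixes r p :: real and S :: nat
  assumes r: "r > 1" and p: "0 < p" "p \<le> 1" and S: "0 < S"
  shows "\<exists>C>0. \<forall>d n. 1 \<le> n \<longrightarrow>
    err d n (ridge_class d r p S) \<le> ennreal (C * (2 powr (r * real d) * real n powr (- r)))"
proof -
  obtain C0 b where C0: "0 < C0" and algo: "\<And>d N V n. \<lbrakk>1 \<le> N; finite V; V \<subseteq> cube d;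
       \<And>a. p_norm d p a \<le> 1 \<Longrightarrow> \<exists>v\<in>V. l1 d a \<le> dot d a v + 2 / real N;
       card V * (2 * N + 1) + b * N + d \<le> n\<rbrakk>
     \<Longrightarrow> err d n (ridge_class d r p S) \<le> ennreal (C0 * real N powr (- r))"
    using err_le_power[OF r p S] by blast
  define c where "c = real b + 4"
  define C where "C = (C0 + 2) * (2 * c) powr r"
  have c: "0 < c" by (simp add: c_def)
  have C: "0 < C" using C0 c by (simp add: C_def)
  have "err d n (ridge_class d r p S) \<le> ennreal (C * (2 powr (r * real d) * real n powr (- r)))"
    if n: "1 \<le> n" for d n
  proof -
    define M where "M = 2 ^ d * (b + 4)"
    define N where "N = n div M"
    have M: "0 < M" "real M = 2 ^ d * c" by (simp_all add: M_def c_def)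
    have "n < M * (N + 1)"
      unfolding N_def using M(1) dividend_less_times_div[of M n] by simp
    then have "real n < real (M * (N + 1))" by (simp only: of_nat_less_iff)
    then have n_less: "real n < real M * (real N + 1)" by (simp only: of_nat_mult of_nat_add of_nat_1)
    have scale: "(real n / (2 * real M)) powr (- r) = (2 * c) powr r * (2 powr (r * real d) * real n powr (- r))"
    proof -
      have "2 * real M = (2 * c) * 2 powr real d" by (simp add: M powr_realpow)
      then show ?thesis
        using c n by (simp add: powr_divide powr_mult powr_powr powr_minus_divide mult_ac)
    qed
    show ?thesis
    proof (cases "N = 0")
      case True
      have "real n / (2 * real M) \<le> 1"
        using n_less True M(1) by (simp add: divide_le_eq)
      then have "1 powr (- r) \<le> (real n / (2 * real M)) powr (- r)"
        using n M(1) r by (intro powr_mono2') auto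
      then have "2 \<le> 2 * (real n / (2 * real M)) powr (- r)" by simp
      also have "\<dots> \<le> C * (2 powr (r * real d) * real n powr (- r))"
        unfolding scale C_def mult.assoc using C0 by (intro mult_right_mono) auto
      finally show ?thesis
        using err_le_2[OF r p] by (meson ennreal_leI order_trans)
    next
      case False
      then have N: "1 \<le> N" by simp
      have "card (sign_vectors d) * (2 * N + 1) + b * N + d
          \<le> 2 ^ d * (3 * N) + 2 ^ d * (b * N) + 2 ^ d * N"
        unfolding card_sign_vectors
      proof (intro add_mono)
        show "b * N \<le> 2 ^ d * (b * N)" by simp
        have "d \<le> 2 ^ d" by (simp add: less_imp_le)
        also have "\<dots> \<le> 2 ^ d * N" using N by simp
        finally show "d \<le> 2 ^ d * N" .
      qed (use N in auto)
      also have "\<dots> = M * N" by (simp add: M_def algebra_simps)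
      also have "\<dots> \<le> n" by (simp add: N_def)
      finally have budget: "card (sign_vectors d) * (2 * N + 1) + b * N + d \<le> n" .
      have "\<exists>v\<in>sign_vectors d. l1 d a \<le> dot d a v + 2 / real N" for a
      proof -
        have "0 \<le> 2 / real N" by simp
        moreover obtain v where "v \<in> sign_vectors d" "l1 d a \<le> dot d a v"
          using norming_sign_vectors by blast
        ultimately show ?thesis by (intro bexI[of _ v]) linarith+
      qed
      then have "err d n (ridge_class d r p S) \<le> ennreal (C0 * real N powr (- r))"
        by (intro algo[OF N finite_sign_vectors sign_vectors_subset_cube _ budget])
      also have "\<dots> \<le> ennreal (C * (2 powr (r * real d) * real n powr (- r)))"
      proof (rule ennreal_leI)
        have "real M * (real N + 1) \<le> real M * (2 * real N)"
          using N by (intro mult_left_mono) auto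
        with n_less have "real n \<le> real N * (2 * real M)" by (simp add: mult_ac)
        then have "real n / (2 * real M) \<le> real N" using M(1) by (simp add: divide_le_eq)
        then have "real N powr (- r) \<le> (real n / (2 * real M)) powr (- r)"
          using r n M(1) by (intro powr_mono2') auto
        then have "C0 * real N powr (- r) \<le> (C0 + 2) * (real n / (2 * real M)) powr (- r)"
          using C0 by (intro mult_mono) auto
        then show "C0 * real N powr (- r) \<le> C * (2 powr (r * real d) * real n powr (- r))"
          by (simp add: scale C_def mult.assoc)
      qed
      finally show ?thesis .
    qed
  qed
  then show ?thesis using C by blast
qed

theorem theorem20:
  fixes p :: real and S :: nat
  assumes "0 < p" and "p \<le> 1" and "0 < S"
  shows "\<exists>c>0. \<forall>r>1. \<exists>C>0. \<forall>d n :: nat. S < d \<longrightarrow>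
     (1 \<le> n \<and> n \<le> 4 * d \<longrightarrow>
        err d n (ridge_class d r p S) \<le> ennreal C) \<and>
     (4 * d \<le> n \<and> real n \<le> c * 2 ^ d * real d powr (1 / p - 1) \<longrightarrow>
        err d n (ridge_class d r p S) \<le> ennreal (C * (1 / ln (real n)) powr (r * (1 / p - 1)))) \<and>
     (real n \<ge> c * 2 ^ d * real d powr (1 / p - 1) \<longrightarrow>
        err d n (ridge_class d r p S) \<le> ennreal (C * (2 powr (r * real d) * real n powr (- r))))"
proof (rule exI[of _ 1], intro conjI allI impI)
  show "(0 :: real) < 1" by simp
  fix r :: real
  assume r: "r > 1"
  obtain C1 where C1: "0 < C1" "\<And>d n. 1 \<le> d \<Longrightarrow> 4 * d \<le> n \<Longrightarrow>
      err d n (ridge_class d r p S) \<le> ennreal (C1 * (1 / ln (real n)) powr (r * (1 / p - 1)))"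
    using err_le_log_power[OF r assms] by blast
  obtain C2 where C2: "0 < C2" "\<And>d n. 1 \<le> n \<Longrightarrow>
      err d n (ridge_class d r p S) \<le> ennreal (C2 * (2 powr (r * real d) * real n powr (- r)))"
    using err_le_power_rate[OF r assms] by blast
  define C where "C = 2 + C1 + C2"
  have C: "0 < C" "2 \<le> C" "C1 \<le> C" "C2 \<le> C" using C1(1) C2(1) by (simp_all add: C_def)
  show "\<exists>C>0. \<forall>d n :: nat. S < d \<longrightarrow>
     (1 \<le> n \<and> n \<le> 4 * d \<longrightarrow>
        err d n (ridge_class d r p S) \<le> ennreal C) \<and>
     (4 * d \<le> n \<and> real n \<le> 1 * 2 ^ d * real d powr (1 / p - 1) \<longrightarrow>
        err d n (ridge_class d r p S) \<le> ennreal (C * (1 / ln (real n)) powr (r * (1 / p - 1)))) \<and>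
     (real n \<ge> 1 * 2 ^ d * real d powr (1 / p - 1) \<longrightarrow>
        err d n (ridge_class d r p S) \<le> ennreal (C * (2 powr (r * real d) * real n powr (- r))))"
  proof (intro exI[of _ C] conjI allI impI)
    fix d n :: nat
    assume d: "S < d"
    show "err d n (ridge_class d r p S) \<le> ennreal C"
      using err_le_2[OF r assms(1,2)] C(2) by (meson ennreal_leI order_trans)
    show "err d n (ridge_class d r p S) \<le> ennreal (C * (1 / ln (real n)) powr (r * (1 / p - 1)))"
      if "4 * d \<le> n \<and> real n \<le> 1 * 2 ^ d * real d powr (1 / p - 1)"
    proof -
      have "err d n (ridge_class d r p S) \<le> ennreal (C1 * (1 / ln (real n)) powr (r * (1 / p - 1)))"
        using that d by (intro C1(2)) auto
      also have "\<dots> \<le> ennreal (C * (1 / ln (real n)) powr (r * (1 / p - 1)))"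
        using C(3) by (intro ennreal_leI mult_right_mono) auto
      finally show ?thesis .
    qed
    show "err d n (ridge_class d r p S) \<le> ennreal (C * (2 powr (r * real d) * real n powr (- r)))"
      if "real n \<ge> 1 * 2 ^ d * real d powr (1 / p - 1)"
    proof -
      have "0 < 1 * 2 ^ d * real d powr (1 / p - 1)" using d by simp
      then have "1 \<le> n" using that by linarith
      then have "err d n (ridge_class d r p S) \<le> ennreal (C2 * (2 powr (r * real d) * real n powr (- r)))"
        by (rule C2(2))
      also have "\<dots> \<le> ennreal (C * (2 powr (r * real d) * real n powr (- r)))"
        using C(4) by (intro ennreal_leI mult_right_mono) auto
      finally show ?thesis .
    qed
  qed (rule C)
qed

end
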